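(* Let $\mathcal H$ be a real Hilbert space, let $C$ be a nonempty closed convex subset of $\mathcal H$, and let $F\colon C^2\to\mathbb R$ satisfy: (i) $F(x,x)=0$ for all $x\in C$; (ii) $F(x,y)+F(y,x)\le0$ for all $(x,y)\in C^2$; (iii) for every $x\in C$, $F(x,\cdot)\colon C\to\mathbb R$ is lower semicontinuous and convex; (iv) $\limsup_{\varepsilon\to0^+}F((1-\varepsilon)x+\varepsilon z,y)\le F(x,y)$ for all $(x,y,z)\in C^3$. Let $(S_i)_{i\in I}$ be a countable (finite or countably infinite) family of closed convex subsets of $\mathcal H$ such that $S=\bigcap_{i\in I}S_i\ne\varnothing$. Let $B\colon\operatorname{dom}B\subset\mathcal H\to\mathcal H$ be monotone and $\chi$-Lipschitz continuous, for some $\chi\in\,]0,+\infty[$, with $C\subset\operatorname{dom}B$, and suppose that $\bigcup_{i\in I}S_i\subset\operatorname{int}\operatorname{dom}B$. Consider the problem $$\text{find } x\in S\cap C\ \text{ such that }\ (\forall y\in C)\quad F(x,y)+\langle Bx\mid y-x\rangle\ge0,\qquad(\ast)$$ and suppose that $(\ast)$ admits at least one solution. Let $(I_n)_{n\in\mathbb N}$ be a sequence of finite subsets of $I$, and suppose that there exist strictly positive integers $(M_i)_{i\in I}$ and $N$ such that $$(\forall(i,n)\in I\times\mathbb N)\quad i\in\bigcup_{k=n}^{n+M_i-1}I_k\quad\text{and}\quad1\le\operatorname{card}I_n\le N.$$ Let $(e_{1,n})_{n\in\mathbb N}$ and $(e_{2,n})_{n\in\mathbb N}$ be sequences in $\mathcal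 H$ such that $\sum_n\|e_{1,n}\|<+\infty$ and $\sum_n\|e_{2,n}\|<+\infty$, and let $(\delta_n)_{n\in\mathbb N}$ be a sequence in $]0,+\infty[$ such that $\sum_n\sqrt{\delta_n}<+\infty$. Let $\varepsilon\in\,]0,1/(\chi+1)[$, let $(\gamma_n)_{n\in\mathbb N}$ be a sequence in $[\varepsilon,(1-\varepsilon)/\chi]$, and, for every $n\in\mathbb N$, let $(\omega_{i,n})_{i\in I_n}$ be numbers in $[\varepsilon,1]$ such that $\sum_{i\in I_n}\omega_{i,n}=1$. Let $x_0\in\operatorname{dom}B$. Then the routine $$(\forall n\in\mathbb N)\quad\begin{cases}y_n=x_n-\gamma_n(Bx_n+e_{1,n})\\ q_n\in J_{\gamma_nF}^{\delta_n}y_n\\ r_n=q_n-\gamma_n(Bq_n+e_{2,n})\\ z_n=x_n-y_n+r_n\\ x_{n+1}=\sum_{i\in I_n}\omega_{i,n}P_{S_i}z_n\end{cases}$$ generates a well-defined infinite sequence $(x_n)_{n\in\mathbb N}$, and $(x_n)_{n\in\mathbb N}$ converges weakly to a solution to $(\ast)$.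
   Context: For $D\subset\mathcal H$ nonempty, closed and convex, $P_D$ denotes the projector onto $D$; $\operatorname{int}$ denotes the interior and $\operatorname{card}$ the cardinality. The operator $B$ is monotone if $\langle x-y\mid Bx-By\rangle\ge0$ for all $x,y\in\operatorname{dom}B$, and $\chi$-Lipschitz continuous if $\|Bx-By\|\le\chi\|x-y\|$ for all $x,y\in\operatorname{dom}B$. For a function $H\colon C^2\to\mathbb R$ and $\delta\in\,]0,+\infty[$, the $\delta$-resolvent of $H$ is the set-valued operator $$J_H^\delta\colon\mathcal H\to2^C\colon x\mapsto\{z\in C : (\forall y\in C)\ H(z,y)+\langle z-x\mid y-z\rangle\ge-\delta\}.$$ In the routine it is applied with $H=\gamma_nF$ and $\delta=\delta_n$.
   Formalization: That the routine never leaves dom B (so generates an infinite sequence) is proved assuming that all averages Σω_{i,n}p_i with p_i∈S_i lie in dom B; without this x_{n+1} may fall outside a nonconvex dom B. Weak convergence of every infinite run needs no such assumption. *)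

theory Defs
  imports "HOL-Analysis.Analysis"
begin

definition monotone_operator_on :: "'a::real_inner set \<Rightarrow> ('a \<Rightarrow> 'a) \<Rightarrow> bool" where
  "monotone_operator_on D B \<longleftrightarrow> (\<forall>x\<in>D. \<forall>y\<in>D. inner (x - y) (B x - B y) \<ge> 0)"

definition lsc_on :: "'a::topological_space set \<Rightarrow> ('a \<Rightarrow> real) \<Rightarrow> bool" where
  "lsc_on C f \<longleftrightarrow> (\<forall>x\<in>C. ereal (f x) \<le> Liminf (at x within C) (\<lambda>y. ereal (f y)))"

text \<open>By the Riesz representation theorem, testing against inner products is the same as
  testing against all bounded linear functionals.\<close>

definition weakly_converges :: "(nat \<Rightarrow> 'a::real_inner) \<Rightarrow> 'a \<Rightarrow> bool" where
  "weakly_converges x l \<longleftrightarrow> (\<forall>u. (\<lambda>n. inner (x n) u) \<longlonglongrightarrow> inner l u)"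

text \<open>The library's \<^emph>\<open>closest_point\<close> needs a Heine-Borel space, which excludes
  infinite-dimensional Hilbert spaces.\<close>

definition nearest_in :: "'a::metric_space set \<Rightarrow> 'a \<Rightarrow> 'a \<Rightarrow> bool" where
  "nearest_in D x p \<longleftrightarrow> p \<in> D \<and> (\<forall>q\<in>D. dist x p \<le> dist x q)"

definition projector :: "'a::metric_space set \<Rightarrow> 'a \<Rightarrow> 'a" where
  "projector D x = (THE p. nearest_in D x p)"

text \<open>The set \<^emph>\<open>J\<close> of the \<open>\<delta>\<close>-resolvent; only the values of \<open>H\<close> on \<open>C \<times> C\<close> matter.\<close>

definition resolvent :: "'a::real_inner set \<Rightarrow> ('a \<Rightarrow> 'a \<Rightarrow> real) \<Rightarrow> real \<Rightarrow> 'a \<Rightarrow> 'a set" where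
  "resolvent C H \<delta> x = {z \<in> C. \<forall>y\<in>C. H z y + inner (z - x) (y - z) \<ge> - \<delta>}"

definition solutions ::
  "'a::real_inner set \<Rightarrow> 'a set \<Rightarrow> ('a \<Rightarrow> 'a \<Rightarrow> real) \<Rightarrow> ('a \<Rightarrow> 'a) \<Rightarrow> 'a set" where
  "solutions S C F B = {x \<in> S \<inter> C. \<forall>y\<in>C. F x y + inner (B x) (y - x) \<ge> 0}"

text \<open>One iteration from \<open>x\<close> to \<open>x'\<close>. It is a relation because the point \<open>q\<close> of the resolvent is
  not unique. A partial operator is a total function \<open>B\<close> with a domain \<open>D\<close>, so the condition
  \<open>x \<in> D\<close> is what makes the evaluation of \<open>B\<close> at \<open>x\<close> legitimate: no iteration starts outside \<open>D\<close>.\<close>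

definition routine_step ::
  "'a::real_inner set \<Rightarrow> ('a \<Rightarrow> 'a) \<Rightarrow> 'a set \<Rightarrow> ('a \<Rightarrow> 'a \<Rightarrow> real) \<Rightarrow> ('i \<Rightarrow> 'a set) \<Rightarrow>
   'i set \<Rightarrow> ('i \<Rightarrow> real) \<Rightarrow> real \<Rightarrow> real \<Rightarrow> 'a \<Rightarrow> 'a \<Rightarrow> 'a \<Rightarrow> 'a \<Rightarrow> bool" where
  "routine_step D B C F S J \<omega> \<gamma> \<delta> e1 e2 x x' \<longleftrightarrow> x \<in> D \<and>
     (\<exists>y q r z.
        y = x - \<gamma> *\<^sub>R (B x + e1) \<and>
        q \<in> resolvent C (\<lambda>u v. \<gamma> * F u v) \<delta> y \<and> q \<in> D \<and>
        r = q - \<gamma> *\<^sub>R (B q + e2) \<and>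
        z = x - y + r \<and>
        x' = (\<Sum>i\<in>J. \<omega> i *\<^sub>R projector (S i) z))"

end

theory Submission
  imports Defs
begin

text \<open>The routine is Tseng's forward-backward-forward splitting for the equilibrium problem, followed
  by an average of projections onto some of the sets \<open>S i\<close>, everything computed up to summable
  errors.

  If \<open>w\<close> is the exact resolvent of \<open>\<gamma> F\<close> at \<open>x - \<gamma> B x\<close>, then the point \<open>w + \<gamma> (B x - B w)\<close> is no
  farther than \<open>x\<close> from every solution \<open>p\<close>, and the squared distance drops by at least
  \<open>(1 - (\<gamma> chi)\<^sup>2) |x - w|\<^sup>2\<close> (\<open>tseng_step\<close>). Averaging projections onto sets that contain \<open>p\<close> lowers it
  further, by at least the weighted squared distances to these sets (\<open>averaged_projections\<close>). The point \<open>z\<close>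
  that the routine computes differs from the exact one by a summable amount, because a
  \<open>\<delta>\<close>-resolvent is within \<open>sqrt \<delta>\<close> of the exact resolvent (\<open>resolvent_error\<close>). Hence the distances
  from the iterates to each solution converge, and all the decrements tend to zero: \<open>x n - w n\<close>
  vanishes, the iterates approach every \<open>S i\<close> (each index is used again within a bounded time), and
  a weak cluster point lies in \<open>C\<close> and in every \<open>S i\<close>. It satisfies the dual inequality
  \<open>F y p + \<langle>B y | p - y\<rangle> \<le> 0\<close> since this passes to weak limits, \<open>F y\<close> being convex and lower
  semicontinuous; Minty's trick (\<open>minty\<close>) turns it into the primal one. Opial's argument (\<open>opial\<close>)
  shows that there is only one cluster point.

  Two compactness facts on an arbitrary real Hilbert space carry this. A family of closed convex sets,
  one of them bounded, has a common point as soon as its finite subfamilies do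
  (\<open>closed_convex_finite_intersection_property\<close>), because the points of almost minimal norm in finite
  intersections form a Cauchy sequence. And every bounded sequence has a weak cluster point
  (\<open>bounded_weak_cluster_filter\<close>): Tychonoff's theorem provides a filter along which all inner
  products converge, and the vector that represents the limits is a common point of the closed convex
  hulls of the tails. Cluster points along filters take the place of weakly convergent
  subsequences.

  The intersection property also gives the projections, and the resolvent: the point sought
  satisfies \<open>\<gamma> F y z + \<langle>z - x | z - y\<rangle> \<le> 0\<close> for all \<open>y\<close> in \<open>C\<close>, a family of closed convex conditions on \<open>z\<close>.
  Finitely many of them can be met up to \<open>e\<close> in the convex hull of the points \<open>y\<close>, by an alternative for
  convex functions (\<open>convex_alternative\<close>) whose other branch contradicts monotonicity
  (\<open>exact_resolvent_exists\<close>).\<close>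

section \<open>Compactness of closed convex sets in Hilbert spaces\<close>

lemma norm_diff_midpoint:
  fixes u v :: "'a::real_inner"
  shows "(norm (u - v))\<^sup>2 = 2 * (norm u)\<^sup>2 + 2 * (norm v)\<^sup>2 - 4 * (norm ((1/2) *\<^sub>R u + (1/2) *\<^sub>R v))\<^sup>2"
  unfolding power2_norm_eq_inner by (simp add: inner_simps inner_commute)

text \<open>Let \<open>s\<close> be the supremum, over finite subfamilies, of the least squared norm of a common point. Two
  common points of a subfamily whose value is within \<open>h\<close> of \<open>s\<close>, both with squared norm below \<open>s + h\<close>, are
  close by the parallelogram identity, since their midpoint is again a common point. Adding any
  further set to the subfamily does not raise the value above \<open>s\<close>, so the limit found along
  a sequence of subfamilies lies in every set.\<close>

lemma closed_convex_finite_intersection_property: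
  fixes \<F> :: "'a::{real_inner,complete_space} set set"
  assumes clo: "\<And>A. A \<in> \<F> \<Longrightarrow> closed A" and cvx: "\<And>A. A \<in> \<F> \<Longrightarrow> convex A"
    and A0: "A0 \<in> \<F>" "bounded A0"
    and fip: "\<And>\<G>. finite \<G> \<Longrightarrow> \<G> \<subseteq> \<F> \<Longrightarrow> \<Inter>\<G> \<noteq> {}"
  shows "\<Inter>\<F> \<noteq> {}"
proof -
  define Fin where "Fin = {\<G>. finite \<G> \<and> \<G> \<subseteq> \<F>}"
  define d where "d \<G> = (INF v\<in>A0 \<inter> \<Inter>\<G>. (norm v)\<^sup>2)" for \<G>
  define s where "s = (SUP \<G>\<in>Fin. d \<G>)"
  define h where "h n = 1 / real (Suc n)" for n
  have h_pos: "h n > 0" for n by (simp add: h_def)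
  have h_lim: "h \<longlonglongrightarrow> 0" unfolding h_def by (rule LIMSEQ_inverse_real_of_nat[unfolded inverse_eq_divide])
  obtain R where R: "\<And>v. v \<in> A0 \<Longrightarrow> norm v \<le> R"
    using A0(2) by (auto simp: bounded_iff)
  have ne: "A0 \<inter> \<Inter>\<G> \<noteq> {}" if "\<G> \<in> Fin" for \<G>
    using fip[of "insert A0 \<G>"] that A0 by (auto simp: Fin_def)
  have bdd: "bdd_below ((\<lambda>v. (norm v)\<^sup>2) ` X)" for X :: "'a set"
    by (rule bdd_belowI[of _ 0]) auto
  have d_le: "d \<G> \<le> (norm v)\<^sup>2" if "v \<in> A0 \<inter> \<Inter>\<G>" for v \<G>
    unfolding d_def using that bdd by (intro cINF_lower) auto
  have d_ub: "d \<G> \<le> R\<^sup>2" if "\<G> \<in> Fin" for \<G>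
  proof -
    from ne[OF that] obtain v where v: "v \<in> A0 \<inter> \<Inter>\<G>" by blast
    have "(norm v)\<^sup>2 \<le> R\<^sup>2" using R[of v] v by (intro power_mono) auto
    then show ?thesis using d_le[OF v] by linarith
  qed
  have bdds: "bdd_above (d ` Fin)" using d_ub by (rule bdd_aboveI2)
  have d_s: "d \<G> \<le> s" if "\<G> \<in> Fin" for \<G>
    unfolding s_def using that bdds by (intro cSUP_upper) auto
  have Fin_ne: "Fin \<noteq> {}" unfolding Fin_def by blast
  have approx: "\<exists>v\<in>A0 \<inter> \<Inter>\<G>. (norm v)\<^sup>2 < s + e" if "\<G> \<in> Fin" "e > 0" for \<G> e
  proof -
    have "d \<G> < s + e" using d_s[OF that(1)] that(2) by linarith
    then show ?thesis unfolding d_def using cINF_less_iff[OF ne[OF that(1)] bdd] by blast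
  qed
  have "\<exists>\<G>\<in>Fin. s - h n < d \<G>" for n
  proof -
    have "s - h n < (SUP \<G>\<in>Fin. d \<G>)" using h_pos[of n] by (simp add: s_def)
    then show ?thesis using less_cSUP_iff[OF Fin_ne bdds] by blast
  qed
  then obtain G where G: "\<And>n. G n \<in> Fin" "\<And>n. s - h n < d (G n)" by metis
  define D where "D n = (\<Union>k\<le>n. G k)" for n
  have D_Fin: "D n \<in> Fin" for n using G(1) by (auto simp: D_def Fin_def)
  have G_D: "G n \<subseteq> D m" if "n \<le> m" for n m using that by (auto simp: D_def)
  have close: "(norm (u - v))\<^sup>2 < 8 * h n"
    if u: "u \<in> A0 \<inter> \<Inter>(G n)" "(norm u)\<^sup>2 < s + h n"
      and v: "v \<in> A0 \<inter> \<Inter>(G n)" "(norm v)\<^sup>2 < s + h n" for u v n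
  proof -
    have "convex (A0 \<inter> \<Inter>(G n))"
      using cvx A0(1) G(1)[of n] by (intro convex_Int convex_Inter) (auto simp: Fin_def)
    then have "(1/2) *\<^sub>R u + (1/2) *\<^sub>R v \<in> A0 \<inter> \<Inter>(G n)"
      by (rule convexD) (use u v in auto)
    from d_le[OF this] G(2)[of n] u(2) v(2) show ?thesis
      unfolding norm_diff_midpoint by linarith
  qed
  have "\<exists>v\<in>A0 \<inter> \<Inter>(D n). (norm v)\<^sup>2 < s + h n" for n using approx[OF D_Fin h_pos] .
  then obtain q where q: "\<And>n. q n \<in> A0 \<inter> \<Inter>(D n)" "\<And>n. (norm (q n))\<^sup>2 < s + h n" by metis
  have h_mono: "h m \<le> h n" if "n \<le> m" for n m using that by (simp add: h_def frac_le)
  have "Cauchy q"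
  proof (rule CauchyI)
    fix e :: real assume "e > 0"
    then have "eventually (\<lambda>n. h n < e\<^sup>2 / 8) sequentially"
      using order_tendstoD(2)[OF h_lim, of "e\<^sup>2 / 8"] by simp
    then obtain K where K: "h K < e\<^sup>2 / 8" by (auto simp: eventually_sequentially)
    have "norm (q m - q n) < e" if "m \<ge> K" "n \<ge> K" for m n
    proof -
      have "(norm (q m - q n))\<^sup>2 < 8 * h K"
      proof (rule close)
        show "q m \<in> A0 \<inter> \<Inter>(G K)" using q(1)[of m] G_D[OF that(1)] by blast
        show "q n \<in> A0 \<inter> \<Inter>(G K)" using q(1)[of n] G_D[OF that(2)] by blast
        show "(norm (q m))\<^sup>2 < s + h K" "(norm (q n))\<^sup>2 < s + h K"
          using q(2)[of m] q(2)[of n] h_mono that by (meson add_left_mono less_le_trans)+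
      qed
      then have "(norm (q m - q n))\<^sup>2 < e\<^sup>2" using K by linarith
      then show ?thesis using \<open>e > 0\<close> by (simp add: power_less_imp_less_base)
    qed
    then show "\<exists>M. \<forall>m\<ge>M. \<forall>n\<ge>M. norm (q m - q n) < e" by blast
  qed
  then obtain p where p: "q \<longlonglongrightarrow> p" using Cauchy_convergent_iff convergent_def by blast
  have "p \<in> A" if "A \<in> \<F>" for A
  proof -
    \<comment> \<open>Almost minimal points chosen inside \<open>A\<close> are forced to the same limit as \<open>q\<close>.\<close>
    have "\<exists>v\<in>A0 \<inter> \<Inter>(insert A (D n)). (norm v)\<^sup>2 < s + h n" for n
      using D_Fin[of n] that h_pos by (intro approx) (auto simp: Fin_def)
    then obtain v where v: "\<And>n. v n \<in> A0 \<inter> \<Inter>(insert A (D n))" "\<And>n. (norm (v n))\<^sup>2 < s + h n"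
      by metis
    have vq: "(norm (v n - q n))\<^sup>2 < 8 * h n" for n
      using v[of n] q[of n] G_D[of n n] by (intro close) blast+
    then have "(\<lambda>n. (norm (v n - q n))\<^sup>2) \<longlonglongrightarrow> 0"
      by (intro tendsto_sandwich[OF _ _ tendsto_const tendsto_mult_right_zero[OF h_lim, of 8]]
          always_eventually allI less_imp_le[OF vq]) auto
    then have "(\<lambda>n. v n - q n) \<longlonglongrightarrow> 0"
      by (simp add: tendsto_norm_zero_iff)
    then have "v \<longlonglongrightarrow> p" using tendsto_add[OF p, of "\<lambda>n. v n - q n" 0] by simp
    moreover have "v n \<in> A" for n using v(1)[of n] by simp
    ultimately show ?thesis using clo[OF that] closed_sequentially[of A v p] by simp
  qed
  then show ?thesis by blast
qed

section \<open>Projections onto closed convex sets\<close>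

text \<open>A nearest point is a common point of the sets \<open>D \<inter> cball x r\<close>, where \<open>r\<close> runs through the radii
  above the distance from \<open>x\<close> to \<open>D\<close>.\<close>

lemma nearest_in_exists:
  fixes D :: "'a::{real_inner,complete_space} set"
  assumes "closed D" "convex D" "D \<noteq> {}"
  shows "\<exists>p. nearest_in D x p"
proof -
  define E where "E r = D \<inter> cball x r" for r
  define m where "m = (INF q\<in>D. dist x q)"
  have m_le: "m \<le> dist x q" if "q \<in> D" for q
    unfolding m_def using that by (intro cINF_lower bdd_belowI[of _ 0]) auto
  have "\<Inter>(E ` {m<..}) \<noteq> {}"
  proof (rule closed_convex_finite_intersection_property[where ?A0.0 = "E (m + 1)"])
    show "E (m + 1) \<in> E ` {m<..}" by (rule imageI) simp
    show "bounded (E (m + 1))" unfolding E_def by (intro bounded_Int) auto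
    show "closed A" "convex A" if "A \<in> E ` {m<..}" for A
      using that assms by (auto simp: E_def intro: closed_Int convex_Int)
    fix \<G> assume "finite \<G>" "\<G> \<subseteq> E ` {m<..}"
    then obtain T where T: "T \<subseteq> {m<..}" "finite T" "\<G> = E ` T" by (meson finite_subset_image)
    define r where "r = Min (insert (m + 1) T)"
    have "r > m" unfolding r_def using T by (subst Min_gr_iff) auto
    then obtain q where q: "q \<in> D" "dist x q < r"
      unfolding m_def using assms(3) cINF_less_iff[of D "dist x" r]
      by (metis bdd_belowI2 zero_le_dist)
    have "q \<in> E t" if "t \<in> T" for t
    proof -
      have "r \<le> t" unfolding r_def using T that by (intro Min_le) auto
      then show ?thesis using q by (simp add: E_def)
    qed
    then show "\<Inter>\<G> \<noteq> {}" using T(3) by blast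
  qed
  then obtain p where p: "\<And>r. r > m \<Longrightarrow> p \<in> E r" by blast
  have "dist x p \<le> m" by (rule field_le_epsilon) (use p in \<open>auto simp: E_def\<close>)
  moreover have "p \<in> D" using p[of "m + 1"] by (auto simp: E_def)
  ultimately have "nearest_in D x p" unfolding nearest_in_def using order_trans[OF _ m_le] by simp
  then show ?thesis by (rule exI)
qed

lemma nearest_in_ex1:
  fixes D :: "'a::{real_inner,complete_space} set"
  assumes "closed D" "convex D" "D \<noteq> {}"
  shows "\<exists>!p. nearest_in D x p"
proof (rule ex_ex1I[OF nearest_in_exists[OF assms]])
  show "p = q" if "nearest_in D x p" "nearest_in D x q" for p q
    by (rule any_closest_point_unique[OF assms(2,1)]) (use that in \<open>auto simp: nearest_in_def\<close>)
qed

lemma projector_nearest: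
  fixes D :: "'a::{real_inner,complete_space} set"
  assumes "closed D" "convex D" "D \<noteq> {}"
  shows "nearest_in D x (projector D x)"
  unfolding projector_def by (rule theI'[OF nearest_in_ex1[OF assms]])

lemma projector_in:
  fixes D :: "'a::{real_inner,complete_space} set"
  assumes "closed D" "convex D" "D \<noteq> {}"
  shows "projector D x \<in> D"
  using projector_nearest[OF assms] by (simp add: nearest_in_def)

text \<open>The variational characterization of the projection, from which its firm nonexpansiveness and the
  weak closedness of closed convex sets follow.\<close>

lemma projector_obtuse:
  fixes D :: "'a::{real_inner,complete_space} set"
  assumes "closed D" "convex D" "q \<in> D"
  shows "inner (x - projector D x) (q - projector D x) \<le> 0"
  using any_closest_point_dot[OF assms(2,1) _ assms(3)] projector_nearest[OF assms(1,2)] assms(3)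
  unfolding nearest_in_def by blast

section \<open>Weak cluster points along filters\<close>

text \<open>Otherwise the inner product with \<open>p - projector D p\<close> separates \<open>p\<close> from \<open>D\<close>, and the points \<open>s n\<close> remain on
  the side of \<open>D\<close>.\<close>

lemma closed_convex_weakly_closed:
  fixes D :: "'a::{real_inner,complete_space} set"
  assumes D: "closed D" "convex D" and G: "G \<noteq> bot"
    and ev: "eventually (\<lambda>n. s n \<in> D) G"
    and lim: "\<And>u. ((\<lambda>n. inner (s n) u) \<longlongrightarrow> inner p u) G"
  shows "p \<in> D"
proof -
  have ne: "D \<noteq> {}" using eventually_happens'[OF G ev] by blast
  define v where "v = p - projector D p"
  have "((\<lambda>n. inner (s n) v - inner (projector D p) v) \<longlongrightarrow> inner p v - inner (projector D p) v) G"
    by (intro tendsto_intros lim)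
  moreover have "eventually (\<lambda>n. inner (s n) v - inner (projector D p) v \<le> 0) G"
    using ev
  proof eventually_elim
    case (elim n)
    then show ?case
      using projector_obtuse[OF D elim, of p]
      by (simp add: v_def inner_diff_left inner_diff_right inner_commute)
  qed
  ultimately have "inner p v - inner (projector D p) v \<le> 0"
    using tendsto_upperbound G by blast
  then have "inner v v \<le> 0" by (simp add: v_def inner_diff_left)
  then have "v = 0" by (metis inner_eq_zero_iff inner_ge_zero order_antisym)
  then show ?thesis using projector_in[OF D ne, of p] by (simp add: v_def)
qed

text \<open>Inner products of \<open>x n\<close> with a fixed vector stay in a compact interval, so by Tychonoff's theorem there
  is a finer filter \<open>G\<close> along which they converge for all vectors at once, say to \<open>L u\<close>. Instead of
  showing that \<open>L\<close> is linear and bounded and representing it, one takes a point \<open>p\<close> common to the closed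
  convex hulls of the sets \<open>x ` A\<close> with \<open>A\<close> in \<open>G\<close>. It represents \<open>L\<close>, because a slab
  \<open>{v. \<bar>\<langle>u | v\<rangle> - L u\<bar> \<le> e}\<close> is closed and convex and contains one of these sets.\<close>

lemma bounded_weak_cluster_filter:
  fixes x :: "'b \<Rightarrow> 'a::{real_inner,complete_space}"
  assumes bdd: "\<And>n. norm (x n) \<le> R" and H: "H \<noteq> bot"
  shows "\<exists>G p. G \<le> H \<and> G \<noteq> bot \<and> (\<forall>u. ((\<lambda>n. inner (x n) u) \<longlongrightarrow> inner p u) G)"
proof -
  define \<Phi> where "\<Phi> n = (\<lambda>u. inner (x n) u)" for n
  define K :: "('a \<Rightarrow> real) set" where "K = (\<Pi>\<^sub>E u\<in>UNIV. {- R * norm u..R * norm u})"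
  have "compactin (product_topology (\<lambda>_. euclidean) UNIV) K"
    unfolding K_def compactin_PiE by simp
  then have K: "compact K" by (simp add: euclidean_product_topology)
  have "\<bar>inner (x n) u\<bar> \<le> R * norm u" for n u
    by (rule order_trans[OF Cauchy_Schwarz_ineq2]) (simp add: bdd mult_right_mono)
  then have inK: "\<Phi> n \<in> K" for n
    unfolding K_def \<Phi>_def by (simp add: PiE_iff abs_le_iff minus_le_iff)
  obtain L where L: "inf (nhds L) (filtermap \<Phi> H) \<noteq> bot"
    using K[unfolded compact_filter, rule_format, of "filtermap \<Phi> H"] H inK
    by (auto simp: filtermap_bot_iff eventually_filtermap)
  define G where "G = inf (filtercomap \<Phi> (nhds L)) H"
  have G_bot: "G \<noteq> bot"
  proof
    assume "G = bot"
    then have "eventually (\<lambda>_. False) (inf (filtercomap \<Phi> (nhds L)) H)" by (simp add: G_def)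
    then obtain P Q where PQ: "eventually P (filtercomap \<Phi> (nhds L))" "eventually Q H"
      "\<And>n. P n \<Longrightarrow> Q n \<Longrightarrow> False" by (auto simp: eventually_inf)
    then obtain P' where P': "eventually P' (nhds L)" "\<And>n. P' (\<Phi> n) \<Longrightarrow> P n"
      by (auto simp: eventually_filtercomap)
    have "eventually (\<lambda>f. \<not> P' f) (filtermap \<Phi> H)"
      unfolding eventually_filtermap using PQ(2) by eventually_elim (use PQ(3) P'(2) in blast)
    then have "eventually (\<lambda>_. False) (inf (nhds L) (filtermap \<Phi> H))"
      using P'(1) by (auto simp: eventually_inf)
    then show False using L by (simp add: eventually_False)
  qed
  have "filterlim \<Phi> (nhds L) G"
    unfolding G_def filterlim_iff_le_filtercomap by simp
  then have "((\<lambda>n. \<Phi> n u) \<longlongrightarrow> L u) G" for u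
    by (rule tendsto_compose[rotated])
      (use continuous_on_product_coordinates[of u, where ?'b = real] in \<open>simp add: continuous_on_def\<close>)
  then have lim: "((\<lambda>n. inner (x n) u) \<longlongrightarrow> L u) G" for u by (simp add: \<Phi>_def)
  have "\<Inter>((\<lambda>A. closure (convex hull (x ` A))) ` {A. eventually (\<lambda>n. n \<in> A) G}) \<noteq> {}" (is "\<Inter>(?h ` ?E) \<noteq> {}")
  proof (rule closed_convex_finite_intersection_property[where ?A0.0 = "?h UNIV"])
    show "?h UNIV \<in> ?h ` ?E" by (rule imageI) simp
    show "bounded (?h UNIV)"
      using bdd by (intro bounded_closure bounded_convex_hull) (auto simp: bounded_iff)
    show "closed A" "convex A" if "A \<in> ?h ` ?E" for A
      using that by (auto intro: convex_closure)
    fix \<G> assume "finite \<G>" "\<G> \<subseteq> ?h ` ?E"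
    then obtain T where T: "T \<subseteq> ?E" "finite T" "\<G> = ?h ` T" by (meson finite_subset_image)
    then have "eventually (\<lambda>n. \<forall>A\<in>T. n \<in> A) G" by (intro eventually_ball_finite) auto
    then obtain n where n: "\<forall>A\<in>T. n \<in> A" using eventually_happens'[OF G_bot] by blast
    have "x n \<in> ?h A" if "A \<in> T" for A
      using n that by (intro subsetD[OF closure_subset] hull_inc imageI) simp
    then show "\<Inter>\<G> \<noteq> {}" using T(3) by blast
  qed
  then obtain p where p: "\<And>A. eventually (\<lambda>n. n \<in> A) G \<Longrightarrow> p \<in> ?h A" by blast
  have "inner p u = L u" for u
  proof -
    have le: "\<bar>inner u p - L u\<bar> \<le> e" if "e > 0" for e
    proof -
      let ?A = "{n. \<bar>inner (x n) u - L u\<bar> \<le> e}"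
      let ?H = "{v. inner u v \<le> L u + e} \<inter> {v. inner u v \<ge> L u - e}"
      have "eventually (\<lambda>n. n \<in> ?A) G"
        using tendstoD[OF lim[of u] \<open>e > 0\<close>] by eventually_elim (auto simp: dist_real_def)
      then have "p \<in> ?h ?A" by (rule p)
      moreover have "?h ?A \<subseteq> ?H"
        by (intro closure_minimal hull_minimal closed_Int convex_Int closed_halfspace_le
            closed_halfspace_ge convex_halfspace_le convex_halfspace_ge)
          (auto simp: abs_le_iff inner_commute algebra_simps)
      ultimately show ?thesis by (auto simp: abs_le_iff)
    qed
    have "\<bar>inner u p - L u\<bar> \<le> 0" by (rule field_le_epsilon) (simp add: le)
    then show ?thesis by (simp add: inner_commute)
  qed
  then have "((\<lambda>n. inner (x n) u) \<longlongrightarrow> inner p u) G" for u using lim[of u] by simp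
  moreover have "G \<le> H" by (simp add: G_def)
  ultimately show ?thesis using G_bot by blast
qed

section \<open>An alternative for convex functions\<close>

text \<open>An alternative for finitely many convex functions: either they can be made simultaneously at most \<open>e\<close>,
  or some convex combination of them is positive throughout. The weights are the positive parts of
  the values at an almost minimizer of the sum of squared positive parts. Boundedness allows an
  almost minimizer in place of a minimizer.\<close>

lemma convex_alternative:
  fixes g :: "'i \<Rightarrow> 'a::real_vector \<Rightarrow> real"
  assumes J: "finite J" and K: "convex K" "K \<noteq> {}"
    and cvx: "\<And>i. i \<in> J \<Longrightarrow> convex_on K (g i)"
    and bdd: "\<And>i z. i \<in> J \<Longrightarrow> z \<in> K \<Longrightarrow> \<bar>g i z\<bar> \<le> L"
    and mix: "\<And>c. (\<And>i. i \<in> J \<Longrightarrow> c i \<ge> 0) \<Longrightarrow> sum c J = 1 \<Longrightarrow> \<exists>z\<in>K. (\<Sum>i\<in>J. c i * g i z) \<le> 0"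
    and e: "e > 0"
  shows "\<exists>z\<in>K. \<forall>i\<in>J. g i z \<le> e"
proof (rule ccontr)
  assume contra: "\<not> ?thesis"
  define \<Phi> where "\<Phi> z = (\<Sum>i\<in>J. (max (g i z) 0)\<^sup>2)" for z
  define m where "m = (INF z\<in>K. \<Phi> z)"
  have big: "e\<^sup>2 \<le> \<Phi> z" if z: "z \<in> K" for z
  proof -
    obtain i where i: "i \<in> J" "g i z > e" using contra z by force
    have "e\<^sup>2 \<le> (max (g i z) 0)\<^sup>2" using i e by (intro power_mono) auto
    also have "\<dots> \<le> \<Phi> z" unfolding \<Phi>_def using i J by (intro member_le_sum) auto
    finally show ?thesis .
  qed
  have bb: "bdd_below (\<Phi> ` K)" using big by (auto intro!: bdd_belowI)
  have "e\<^sup>2 \<le> m" unfolding m_def using K big by (intro cINF_greatest) auto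
  moreover have "e\<^sup>2 > 0" using e by simp
  ultimately have m: "m > 0" by linarith
  have m_le: "m \<le> \<Phi> z" if "z \<in> K" for z unfolding m_def using that bb by (intro cINF_lower)
  \<comment> \<open>Moving from \<open>z0\<close> towards \<open>z\<close> by \<open>t\<close> changes \<open>\<Phi>\<close> by at most \<open>- 2 t m + t\<^sup>2 k\<close>, which is
    \<open>- t m\<close> for \<open>t = m / k\<close>. As \<open>z0\<close> is chosen with \<open>\<Phi> z0 < m + t m\<close>, the value falls below the infimum
    \<open>m\<close>. The summand \<open>m\<close> of \<open>k\<close> ensures \<open>t \<le> 1\<close>.\<close>
  define k where "k = (\<Sum>i\<in>J. (2 * L)\<^sup>2) + m"
  have k: "k \<ge> m" unfolding k_def by (simp add: sum_nonneg)
  define t where "t = m / k"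
  have t: "t > 0" "t \<le> 1" "t * k = m" using m k by (auto simp: t_def)
  have "m < m + t * m" using t m by simp
  then obtain z0 where z0: "z0 \<in> K" "\<Phi> z0 < m + t * m"
    using cINF_less_iff[OF K(2) bb, of "m + t * m"] unfolding m_def by blast
  define a where "a i = max (g i z0) 0" for i
  have a0: "a i \<ge> 0" for i by (simp add: a_def)
  have "sum a J \<noteq> 0"
  proof
    assume "sum a J = 0"
    then have "\<forall>i\<in>J. a i = 0" using J a0 by (simp add: sum_nonneg_eq_0_iff)
    then have "\<Phi> z0 = 0" by (simp add: \<Phi>_def a_def)
    then show False using m_le[OF z0(1)] m by simp
  qed
  then have sa: "sum a J > 0" using sum_nonneg[of J a] a0 by fastforce
  have "\<exists>z\<in>K. (\<Sum>i\<in>J. (a i / sum a J) * g i z) \<le> 0"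
    by (rule mix) (use a0 sa in \<open>auto simp: sum_divide_distrib[symmetric]\<close>)
  then obtain z where z: "z \<in> K" "(\<Sum>i\<in>J. (a i / sum a J) * g i z) \<le> 0" by blast
  have "(\<Sum>i\<in>J. (a i / sum a J) * g i z) = (\<Sum>i\<in>J. a i * g i z) / sum a J"
    by (simp add: sum_divide_distrib)
  then have ag: "(\<Sum>i\<in>J. a i * g i z) \<le> 0" using z(2) sa by (simp add: divide_le_0_iff)
  define w where "w = (1 - t) *\<^sub>R z0 + t *\<^sub>R z"
  have w: "w \<in> K" unfolding w_def using K(1) z0 z t by (intro convexD_alt) auto
  have "\<Phi> w \<le> (\<Sum>i\<in>J. (a i + t * (g i z - a i))\<^sup>2)"
    unfolding \<Phi>_def
  proof (rule sum_mono)
    fix i assume i: "i \<in> J"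
    have "g i w \<le> (1 - t) * g i z0 + t * g i z"
      unfolding w_def using convex_onD[OF cvx[OF i]] t z0 z by auto
    also have "\<dots> \<le> (1 - t) * a i + t * g i z"
      using t by (intro add_right_mono mult_left_mono) (auto simp: a_def)
    also have "\<dots> = a i + t * (g i z - a i)" by (simp add: algebra_simps)
    finally have "max (g i w) 0 \<le> \<bar>a i + t * (g i z - a i)\<bar>" by linarith
    then have "\<bar>max (g i w) 0\<bar> \<le> \<bar>a i + t * (g i z - a i)\<bar>" by simp
    then show "(max (g i w) 0)\<^sup>2 \<le> (a i + t * (g i z - a i))\<^sup>2" unfolding abs_le_square_iff .
  qed
  also have "\<dots> = (\<Sum>i\<in>J. (a i)\<^sup>2 + 2 * t * (a i * g i z) - 2 * t * (a i)\<^sup>2 + t\<^sup>2 * (g i z - a i)\<^sup>2)"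
    by (rule sum.cong) (auto simp: power2_eq_square algebra_simps)
  also have "\<dots> = \<Phi> z0 + 2 * t * (\<Sum>i\<in>J. a i * g i z) - 2 * t * \<Phi> z0 + t\<^sup>2 * (\<Sum>i\<in>J. (g i z - a i)\<^sup>2)"
    by (simp add: sum.distrib sum_subtractf sum_distrib_left[symmetric] \<Phi>_def a_def)
  also have "\<dots> \<le> \<Phi> z0 + 0 - 2 * t * m + t\<^sup>2 * k"
  proof -
    have "2 * t * (\<Sum>i\<in>J. a i * g i z) \<le> 0" using ag t by (simp add: mult_nonneg_nonpos)
    moreover have "2 * t * m \<le> 2 * t * \<Phi> z0" using m_le[OF z0(1)] t by simp
    moreover have "(\<Sum>i\<in>J. (g i z - a i)\<^sup>2) \<le> (\<Sum>i\<in>J. (2 * L)\<^sup>2)"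
    proof (rule sum_mono)
      fix i assume i: "i \<in> J"
      have "\<bar>g i z - a i\<bar> \<le> 2 * L" using bdd[OF i z(1)] bdd[OF i z0(1)] by (simp add: a_def)
      also have "\<dots> \<le> \<bar>2 * L\<bar>" by simp
      finally show "(g i z - a i)\<^sup>2 \<le> (2 * L)\<^sup>2" by (simp add: abs_le_square_iff)
    qed
    then have "t\<^sup>2 * (\<Sum>i\<in>J. (g i z - a i)\<^sup>2) \<le> t\<^sup>2 * k"
      using m by (intro mult_left_mono) (auto simp: k_def)
    ultimately show ?thesis by linarith
  qed
  also have "t\<^sup>2 * k = t * m" using t(3) by (simp add: power2_eq_square mult.assoc)
  finally show False using m_le[OF w] z0(2) by linarith
qed

section \<open>Lower semicontinuous convex functions\<close>

lemma lsc_onD: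
  assumes "lsc_on C f" "x \<in> C" "c < f x"
  shows "eventually (\<lambda>y. y \<in> C \<longrightarrow> c < f y) (nhds x)"
proof -
  have "ereal c < Liminf (at x within C) (\<lambda>y. ereal (f y))"
    using assms unfolding lsc_on_def by (meson ereal_less_eq(3) less_ereal.simps(1) less_le_trans)
  then have "eventually (\<lambda>y. c < f y) (at x within C)"
    using less_LiminfD by fastforce
  then show ?thesis
    unfolding eventually_at_filter using assms(3) by (auto elim: eventually_mono)
qed

lemma closed_sublevel_lsc_plus_continuous:
  fixes f g :: "'a::metric_space \<Rightarrow> real"
  assumes C: "closed C" and f: "lsc_on C f" and g: "continuous_on UNIV g" and k: "k > 0"
  shows "closed {z \<in> C. k * f z + g z \<le> c}"
  unfolding closed_sequential_limits
proof (intro allI impI, elim conjE)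
  fix s l assume s: "\<forall>n. s n \<in> {z \<in> C. k * f z + g z \<le> c}" and l: "s \<longlonglongrightarrow> l"
  have lC: "l \<in> C" using closed_sequentially[OF C _ l] s by blast
  have "k * f l + g l \<le> c"
  proof (rule ccontr)
    assume "\<not> ?thesis"
    then have e: "c - g l < k * f l" by simp
    define m where "m = (c - g l + k * f l) / 2"
    have m: "m / k < f l" "c - m < g l" using e k by (auto simp: m_def field_simps)
    have "eventually (\<lambda>n. s n \<in> C \<longrightarrow> m / k < f (s n)) sequentially"
      using filterlim_iff[THEN iffD1, OF l] lsc_onD[OF f lC m(1)] by blast
    moreover have "(\<lambda>n. g (s n)) \<longlonglongrightarrow> g l"
      using g l by (metis UNIV_I continuous_on_tendsto_compose eventually_sequentiallyI)
    then have "eventually (\<lambda>n. c - m < g (s n)) sequentially" using m(2) by (rule order_tendstoD)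
    ultimately have "eventually (\<lambda>n. False) sequentially"
    proof eventually_elim
      case (elim n)
      then have "m < k * f (s n)" using s k by (simp add: field_simps)
      then show False using elim(2) s[rule_format, of n] by simp
    qed
    then show False by simp
  qed
  then show "l \<in> {z \<in> C. k * f z + g z \<le> c}" using lC by simp
qed

lemma convex_sublevel:
  assumes "convex_on C f"
  shows "convex {z \<in> C. f z \<le> (c::real)}"
proof (rule convexI)
  fix x y and u v :: real
  assume xy: "x \<in> {z \<in> C. f z \<le> c}" "y \<in> {z \<in> C. f z \<le> c}" and uv: "0 \<le> u" "0 \<le> v" "u + v = 1"
  have "f (u *\<^sub>R x + v *\<^sub>R y) \<le> u * f x + v * f y"
    using assms xy uv unfolding convex_on_def by blast
  also have "\<dots> \<le> c" using xy uv by (intro convex_bound_le) auto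
  finally show "u *\<^sub>R x + v *\<^sub>R y \<in> {z \<in> C. f z \<le> c}"
    using assms xy uv unfolding convex_on_def by (auto intro: convexD)
qed

text \<open>Lower semicontinuity bounds \<open>f\<close> from below on a ball around \<open>a\<close>. Convexity propagates this bound along
  rays from \<open>a\<close>, at the price of a linear term; thus quadratic terms dominate \<open>f\<close> at infinity.\<close>

lemma convex_lsc_affine_growth:
  fixes f :: "'a::real_normed_vector \<Rightarrow> real"
  assumes f: "lsc_on C f" "convex_on C f" and a: "a \<in> C"
  shows "\<exists>M\<ge>0. \<forall>z\<in>C. f z \<ge> f a - 1 - M * norm (z - a)"
proof -
  have "eventually (\<lambda>z. z \<in> C \<longrightarrow> f a - 1 < f z) (nhds a)" using lsc_onD[OF f(1) a] by simp
  then obtain r where r: "r > 0" "\<And>z. dist z a < r \<Longrightarrow> z \<in> C \<Longrightarrow> f a - 1 < f z"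
    unfolding eventually_nhds_metric by blast
  define M where "M = 2 / r"
  have "f z \<ge> f a - 1 - M * norm (z - a)" if z: "z \<in> C" for z
  proof (cases "norm (z - a) < r")
    case True
    then have "f z \<ge> f a - 1" using r(2)[of z] z by (auto simp: dist_norm)
    then show ?thesis using r(1) by (simp add: M_def) (smt (verit) divide_nonneg_pos norm_ge_zero)
  next
    case False
    \<comment> \<open>The factor that pulls \<open>z\<close> back to the distance \<open>r / 2\<close> from \<open>a\<close>.\<close>
    define t where "t = r / (2 * norm (z - a))"
    have n: "norm (z - a) > 0" using False r(1) by linarith
    have t: "t > 0" "t \<le> 1" "t * norm (z - a) = r / 2" "1 / t = M * norm (z - a)"
      using False r(1) n by (auto simp: t_def M_def field_simps)
    define w where "w = (1 - t) *\<^sub>R a + t *\<^sub>R z"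
    have wa: "w - a = t *\<^sub>R (z - a)" by (simp add: w_def algebra_simps)
    have "w \<in> C" unfolding w_def
      using f(2) a z t convexD_alt[of C a z t] by (auto simp: convex_on_def)
    moreover have "dist w a < r" using t r(1) by (simp add: dist_norm wa)
    ultimately have "f a - 1 < f w" by (rule r(2)[rotated])
    also have "f w \<le> (1 - t) * f a + t * f z"
      unfolding w_def using convex_onD[OF f(2)] a z t by auto
    finally have "t * (f a - f z) < 1" by (simp add: algebra_simps)
    then have "f a - f z < 1 / t" using t by (simp add: field_simps)
    then show ?thesis using t by simp
  qed
  then show ?thesis using r(1) by (intro exI[of _ M]) (auto simp: M_def)
qed

lemma inner_quadratic_convex:
  fixes a y :: "'a::real_inner"
  assumes "convex C"
  shows "convex_on C (\<lambda>z. inner (z - a) (z - y))"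
proof (rule convex_onI[OF _ assms])
  fix t :: real and u v assume t: "0 < t" "t < 1"
  have "(1 - t) * inner (u - a) (u - y) + t * inner (v - a) (v - y)
      - inner ((1 - t) *\<^sub>R u + t *\<^sub>R v - a) ((1 - t) *\<^sub>R u + t *\<^sub>R v - y)
      = t * (1 - t) * inner (u - v) (u - v)"
    by (simp add: inner_simps inner_commute algebra_simps)
  moreover have "t * (1 - t) * inner (u - v) (u - v) \<ge> 0" using t by simp
  ultimately show "inner ((1 - t) *\<^sub>R u + t *\<^sub>R v - a) ((1 - t) *\<^sub>R u + t *\<^sub>R v - y)
      \<le> (1 - t) * inner (u - a) (u - y) + t * inner (v - a) (v - y)" by linarith
qed

section \<open>Monotone equilibrium bifunctions\<close>

locale equilibrium_bifunction =
  fixes C :: "'a::{real_inner,complete_space} set" and F :: "'a \<Rightarrow> 'a \<Rightarrow> real"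
  assumes C_nonempty: "C \<noteq> {}" and C_closed: "closed C" and C_convex: "convex C"
    and F_diag: "x \<in> C \<Longrightarrow> F x x = 0"
    and F_mono: "x \<in> C \<Longrightarrow> y \<in> C \<Longrightarrow> F x y + F y x \<le> 0"
    and F_lsc: "x \<in> C \<Longrightarrow> lsc_on C (F x)"
    and F_convex: "x \<in> C \<Longrightarrow> convex_on C (F x)"
    and F_hemi: "x \<in> C \<Longrightarrow> y \<in> C \<Longrightarrow> z \<in> C \<Longrightarrow>
      Limsup (at_right 0) (\<lambda>t. ereal (F ((1 - t) *\<^sub>R x + t *\<^sub>R z) y)) \<le> ereal (F x y)"
begin

text \<open>Minty's trick. For \<open>p\<close> on the segment from \<open>z\<close> to \<open>y\<close>, the diagonal value \<open>F p p = 0\<close> is at most a convex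
  combination of \<open>F p z\<close> and \<open>F p y\<close>. The hypothesis at \<open>p\<close> bounds the first by a multiple of the step, so
  division by the step and hemicontinuity as \<open>p\<close> tends to \<open>z\<close> give the claim. The summand with \<open>A\<close> serves
  both for the operator \<open>B\<close> and for the term \<open>\<langle>z - x | y - z\<rangle>\<close> of a resolvent.\<close>

lemma minty:
  assumes k: "k > 0" and A: "continuous_on C A" and z: "z \<in> C"
    and le: "\<And>y. y \<in> C \<Longrightarrow> k * F y z + inner (A y) (z - y) \<le> 0"
    and y: "y \<in> C"
  shows "k * F z y + inner (A z) (y - z) \<ge> 0"
proof (rule ccontr)
  assume neg: "\<not> ?thesis"
  define c where "c = inner (A z) (y - z)"
  define m where "m = (k * F z y - c) / 2"
  define p where "p t = (1 - t) *\<^sub>R z + t *\<^sub>R y" for t :: real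
  have m: "F z y < m / k" "c < - m" using neg k by (auto simp: m_def c_def field_simps)
  have in01: "eventually (\<lambda>t::real. t \<in> {0<..<1}) (at_right 0)"
    by (rule eventually_at_right_real) simp
  have pC: "p t \<in> C" if "t \<in> {0<..<1}" for t
    unfolding p_def using that C_convex z y by (intro convexD_alt) auto
  have p0: "(p \<longlongrightarrow> z) (at_right 0)"
    unfolding p_def by (auto intro!: tendsto_eq_intros)
  have "Limsup (at_right 0) (\<lambda>t. ereal (F (p t) y)) < ereal (m / k)"
    using F_hemi[OF z y y] m(1) unfolding p_def by (meson ereal_less_eq le_less_trans less_ereal.simps(1))
  then have "eventually (\<lambda>t. F (p t) y < m / k) (at_right 0)"
    using Limsup_lessD by fastforce
  moreover have "((\<lambda>t. A (p t)) \<longlongrightarrow> A z) (at_right 0)"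
    by (rule continuous_on_tendsto_compose[OF A p0 z]) (use in01 pC in \<open>auto elim: eventually_mono\<close>)
  then have "((\<lambda>t. (1 - t) * inner (A (p t)) (y - z)) \<longlongrightarrow> (1 - 0) * c) (at_right 0)"
    unfolding c_def by (intro tendsto_intros)
  then have "((\<lambda>t. (1 - t) * inner (A (p t)) (y - z)) \<longlongrightarrow> c) (at_right 0)" by simp
  then have "eventually (\<lambda>t. (1 - t) * inner (A (p t)) (y - z) < - m) (at_right 0)"
    using m(2) by (rule order_tendstoD)
  ultimately have "eventually (\<lambda>t::real. False) (at_right 0)" using in01
  proof eventually_elim
    case (elim t)
    note pt = pC[OF elim(3)]
    have "0 = k * F (p t) (p t)" using F_diag[OF pt] by simp
    also have "\<dots> \<le> k * ((1 - t) * F (p t) z + t * F (p t) y)"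
      using k convex_onD[OF F_convex[OF pt], of t z y] elim(3) z y
      by (intro mult_left_mono) (auto simp: p_def[of t, symmetric])
    also have "\<dots> = (1 - t) * (k * F (p t) z) + t * (k * F (p t) y)" by (simp add: algebra_simps)
    also have "\<dots> \<le> (1 - t) * - inner (A (p t)) (z - p t) + t * (k * F (p t) y)"
      using le[OF pt] elim(3) by (intro add_right_mono mult_left_mono) auto
    also have "z - p t = - t *\<^sub>R (y - z)" by (simp add: p_def algebra_simps)
    also have "(1 - t) * - inner (A (p t)) (- t *\<^sub>R (y - z)) + t * (k * F (p t) y)
        = t * ((1 - t) * inner (A (p t)) (y - z) + k * F (p t) y)"
      by (simp add: algebra_simps)
    finally have "0 \<le> (1 - t) * inner (A (p t)) (y - z) + k * F (p t) y"
      using elim(3) by (simp add: zero_le_mult_iff)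
    moreover have "k * F (p t) y < m" using elim(1) k by (simp add: field_simps)
    ultimately show False using elim(2) by linarith
  qed
  then show False by simp
qed

lemma sublevel_closed_convex:
  assumes y: "y \<in> C" and k: "k > 0" and g: "continuous_on UNIV g" "convex_on C g"
  shows "closed {z \<in> C. k * F y z + g z \<le> c}" "convex {z \<in> C. k * F y z + g z \<le> c}"
proof -
  show "closed {z \<in> C. k * F y z + g z \<le> c}"
    by (rule closed_sublevel_lsc_plus_continuous[OF C_closed F_lsc[OF y] g(1) k])
  have "convex_on C (\<lambda>z. k * F y z + g z)"
    using convex_on_add[OF convex_on_cmul[OF _ F_convex[OF y]] g(2), of k] k by simp
  then show "convex {z \<in> C. k * F y z + g z \<le> c}"
    by (rule convex_sublevel)
qed

text \<open>Convexity in the second argument bounds the sum by the double sum of \<open>c y * c w * F y w\<close>, in which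
  monotonicity makes the pairs \<open>(y, w)\<close> and \<open>(w, y)\<close> contribute a nonpositive amount together.\<close>

lemma diagonal_average_nonpos:
  assumes Y: "finite Y" "Y \<subseteq> C" and c: "\<And>y. y \<in> Y \<Longrightarrow> c y \<ge> 0" "sum c Y = 1"
  shows "(\<Sum>y\<in>Y. c y * F y (\<Sum>w\<in>Y. c w *\<^sub>R w)) \<le> 0"
proof -
  have Yne: "Y \<noteq> {}" using c(2) by auto
  define s where "s = (\<Sum>y\<in>Y. \<Sum>w\<in>Y. c y * c w * F y w)"
  have "(\<Sum>y\<in>Y. c y * F y (\<Sum>w\<in>Y. c w *\<^sub>R w)) \<le> (\<Sum>y\<in>Y. c y * (\<Sum>w\<in>Y. c w * F y w))"
    using Y c by (intro sum_mono mult_left_mono convex_on_sum[OF Y(1) Yne F_convex c(2)]) auto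
  also have "\<dots> = s" by (simp add: s_def sum_distrib_left mult.assoc)
  finally have le: "(\<Sum>y\<in>Y. c y * F y (\<Sum>w\<in>Y. c w *\<^sub>R w)) \<le> s" .
  have "s = (\<Sum>y\<in>Y. \<Sum>w\<in>Y. c w * c y * F w y)" unfolding s_def by (rule sum.swap)
  then have "2 * s = s + (\<Sum>y\<in>Y. \<Sum>w\<in>Y. c y * c w * F w y)" by (simp add: mult.commute)
  also have "\<dots> = (\<Sum>y\<in>Y. \<Sum>w\<in>Y. c y * c w * (F y w + F w y))"
    by (simp add: s_def sum.distrib distrib_left)
  also have "\<dots> \<le> 0"
    using Y c F_mono by (intro sum_nonpos mult_nonneg_nonpos mult_nonneg_nonneg) blast+
  finally show ?thesis using le by linarith
qed

text \<open>By \<open>minty\<close> it suffices to satisfy \<open>k * F y z + \<langle>z - x | z - y\<rangle> \<le> 0\<close> for all \<open>y\<close>, which is stronger than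
  the dual inequality by \<open>|z - y|\<^sup>2\<close>. The quadratic term makes the sublevel sets \<open>T y e\<close> bounded. At a convex
  combination \<open>z\<close> of the points \<open>y\<close> the terms \<open>\<langle>z - x | z - y\<rangle>\<close> average to zero, so
  \<open>diagonal_average_nonpos\<close> excludes the second branch of the alternative for convex functions.\<close>

lemma exact_resolvent_exists:
  assumes k: "k > 0"
  shows "\<exists>z. z \<in> resolvent C (\<lambda>u v. k * F u v) 0 x"
proof -
  define q where "q y z = inner (z - x) (z - y)" for y z
  define g where "g y z = k * F y z + q y z" for y z
  define T where "T y e = {z \<in> C. g y z \<le> e}" for y e
  have q_cont: "continuous_on UNIV (q y)" for y
    unfolding q_def by (intro continuous_intros)
  have q_cvx: "convex_on C (q y)" for y
    unfolding q_def by (rule inner_quadratic_convex[OF C_convex])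
  have g_cvx: "convex_on C (g y)" if "y \<in> C" for y
    unfolding g_def using convex_on_add[OF convex_on_cmul[OF _ F_convex[OF that]] q_cvx, of k] k by simp
  have T: "closed (T y e)" "convex (T y e)" if "y \<in> C" for y e
    unfolding T_def g_def using sublevel_closed_convex[OF that k q_cont q_cvx] by auto
  have growth: "\<exists>M\<ge>0. \<forall>z\<in>C. k * F y z \<ge> - k - M * norm (z - y)" if y: "y \<in> C" for y
  proof -
    obtain M where M: "M \<ge> 0" "\<And>z. z \<in> C \<Longrightarrow> F y z \<ge> F y y - 1 - M * norm (z - y)"
      using convex_lsc_affine_growth[OF F_lsc[OF y] F_convex[OF y] y] by blast
    have "k * F y z \<ge> - k - (k * M) * norm (z - y)" if "z \<in> C" for z
      using mult_left_mono[OF M(2)[OF that], of k] k F_diag[OF y] by (simp add: algebra_simps)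
    then show ?thesis using M(1) k by (intro exI[of _ "k * M"]) auto
  qed
  obtain a where a: "a \<in> C" using C_nonempty by blast
  have T_bdd: "bounded (T a 1)"
  proof -
    obtain M where M: "M \<ge> 0" "\<And>z. z \<in> C \<Longrightarrow> k * F a z \<ge> - k - M * norm (z - a)"
      using growth[OF a] by blast
    define b where "b = M + norm (a - x)"
    have "norm (z - a) \<le> 1 + k + b" if z: "z \<in> T a 1" for z
    proof (rule ccontr)
      assume "\<not> ?thesis"
      then have n: "norm (z - a) > 1 + k + b" by simp
      have b0: "b \<ge> 0" using M by (simp add: b_def)
      have "q a z = (norm (z - a))\<^sup>2 + inner (a - x) (z - a)"
        by (simp add: q_def power2_norm_eq_inner inner_simps inner_commute)
      moreover have "inner (a - x) (z - a) \<ge> - (norm (a - x) * norm (z - a))"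
        using Cauchy_Schwarz_ineq2[of "a - x" "z - a"] by linarith
      moreover have "k * F a z + q a z \<le> 1" "k * F a z \<ge> - k - M * norm (z - a)"
        using z M(2) by (auto simp: T_def g_def)
      ultimately have "(norm (z - a))\<^sup>2 \<le> 1 + k + b * norm (z - a)"
        by (simp add: b_def algebra_simps)
      moreover have "(1 + k + b) * norm (z - a) < norm (z - a) * norm (z - a)"
        using n b0 k by (intro mult_strict_right_mono) auto
      moreover have "(1 + k) * 1 \<le> (1 + k) * norm (z - a)"
        using n b0 k by (intro mult_left_mono) auto
      ultimately show False by (simp add: power2_eq_square algebra_simps)
    qed
    then have "T a 1 \<subseteq> cball a (1 + k + b)"
      by (auto simp: dist_norm norm_minus_commute)
    then show ?thesis using bounded_cball bounded_subset by blast
  qed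
  have fin: "\<exists>z. \<forall>y\<in>Y. z \<in> T y e" if Y: "finite Y" "Y \<subseteq> C" "Y \<noteq> {}" and e: "e > 0" for Y e
  proof -
    define K where "K = convex hull Y"
    have KC: "K \<subseteq> C" unfolding K_def using Y C_convex by (simp add: subset_hull)
    have YK: "Y \<subseteq> K" unfolding K_def by (rule hull_subset)
    have K: "convex K" "K \<noteq> {}" using Y by (auto simp: K_def)
    have "bounded K" unfolding K_def using Y(1) by (intro bounded_convex_hull finite_imp_bounded)
    then obtain R where R: "R > 0" "\<And>z. z \<in> K \<Longrightarrow> norm z \<le> R" using bounded_pos by blast
    have "\<exists>L. \<forall>z\<in>K. \<bar>g y z\<bar> \<le> L" if y: "y \<in> Y" for y
    proof -
      have yC: "y \<in> C" using y Y by blast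
      define U where "U = (\<Sum>w\<in>Y. \<bar>g y w\<bar>)"
      have "\<forall>z\<in>K. g y z \<le> U" unfolding K_def
      proof (rule convex_on_convex_hull_bound)
        show "convex_on (convex hull Y) (g y)"
          using convex_on_subset[OF g_cvx[OF yC] KC K(1)] by (simp add: K_def)
        have "\<bar>g y w\<bar> \<le> U" if "w \<in> Y" for w
          unfolding U_def by (rule member_le_sum) (use that Y in auto)
        then show "\<forall>w\<in>Y. g y w \<le> U" by (meson abs_le_D1)
      qed
      obtain M where M: "M \<ge> 0" "\<And>z. z \<in> C \<Longrightarrow> k * F y z \<ge> - k - M * norm (z - y)"
        using growth[OF yC] by blast
      have "g y z \<ge> - (k + M * (2 * R) + (R + norm x) * (2 * R))" if z: "z \<in> K" for z
      proof -
        have n: "norm (z - y) \<le> 2 * R" "norm (z - x) \<le> R + norm x"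
          using R(2)[OF z] R(2)[of y] y YK norm_triangle_ineq4[of z y] norm_triangle_ineq4[of z x]
          by (auto simp: subset_iff)
        have "\<bar>q y z\<bar> \<le> norm (z - x) * norm (z - y)" unfolding q_def by (rule Cauchy_Schwarz_ineq2)
        also have "\<dots> \<le> (R + norm x) * (2 * R)" using n R(1) by (intro mult_mono) auto
        finally have "q y z \<ge> - ((R + norm x) * (2 * R))" by linarith
        moreover have "M * norm (z - y) \<le> M * (2 * R)" using n M(1) by (intro mult_left_mono) auto
        moreover have "k * F y z \<ge> - k - M * norm (z - y)" using M(2) z KC by blast
        ultimately show ?thesis unfolding g_def by linarith
      qed
      with \<open>\<forall>z\<in>K. g y z \<le> U\<close> show ?thesis
        by (intro exI[of _ "\<bar>U\<bar> + \<bar>k + M * (2 * R) + (R + norm x) * (2 * R)\<bar>"]) (smt (verit))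
    qed
    then obtain L where L: "\<And>y z. y \<in> Y \<Longrightarrow> z \<in> K \<Longrightarrow> \<bar>g y z\<bar> \<le> L y" by metis
    have "\<exists>z\<in>K. \<forall>y\<in>Y. g y z \<le> e"
    proof (rule convex_alternative[OF Y(1) K _ _ _ e])
      show "convex_on K (g y)" if "y \<in> Y" for y
        using convex_on_subset[OF g_cvx KC K(1)] that Y(2) by blast
      show "\<bar>g y z\<bar> \<le> Max (L ` Y)" if "y \<in> Y" "z \<in> K" for y z
        by (rule order_trans[OF L[OF that] Max_ge]) (use Y(1) that in auto)
      fix c :: "'a \<Rightarrow> real" assume c: "\<And>y. y \<in> Y \<Longrightarrow> 0 \<le> c y" "sum c Y = 1"
      define z where "z = (\<Sum>w\<in>Y. c w *\<^sub>R w)"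
      have "z \<in> K" unfolding z_def using K(1) Y(1) YK c by (intro convex_sum) auto
      moreover have "(\<Sum>y\<in>Y. c y * q y z) = 0"
      proof -
        have "(\<Sum>y\<in>Y. c y *\<^sub>R (z - y)) = (\<Sum>y\<in>Y. c y) *\<^sub>R z - z"
          by (simp add: scaleR_right_diff_distrib sum_subtractf scaleR_left.sum z_def)
        then have "inner (z - x) (\<Sum>y\<in>Y. c y *\<^sub>R (z - y)) = 0" using c(2) by simp
        then show ?thesis by (simp add: inner_sum_right q_def)
      qed
      then have "(\<Sum>y\<in>Y. c y * g y z) = k * (\<Sum>y\<in>Y. c y * F y z)"
        by (simp add: g_def distrib_left sum.distrib sum_distrib_left mult.left_commute)
      then have "(\<Sum>y\<in>Y. c y * g y z) \<le> 0"
        using diagonal_average_nonpos[OF Y(1,2) c] k by (simp add: z_def mult_nonneg_nonpos)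
      ultimately show "\<exists>z\<in>K. (\<Sum>y\<in>Y. c y * g y z) \<le> 0" by blast
    qed
    then show ?thesis using KC by (auto simp: T_def)
  qed
  have "\<Inter>(case_prod T ` (C \<times> {0<..})) \<noteq> {}"
  proof (rule closed_convex_finite_intersection_property[where ?A0.0 = "T a 1"])
    show "T a 1 \<in> case_prod T ` (C \<times> {0<..})" using a by (intro image_eqI[of _ _ "(a, 1)"]) auto
    show "bounded (T a 1)" by (rule T_bdd)
    show "closed A" "convex A" if "A \<in> case_prod T ` (C \<times> {0<..})" for A
      using that T by auto
    fix \<G> assume "finite \<G>" "\<G> \<subseteq> case_prod T ` (C \<times> {0<..})"
    then obtain P where P: "P \<subseteq> C \<times> {0<..}" "finite P" "\<G> = case_prod T ` P"
      by (meson finite_subset_image)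
    define e where "e = Min (insert 1 (snd ` P))"
    have e0: "e > 0" unfolding e_def using P by (subst Min_gr_iff) auto
    obtain z where z: "\<forall>y\<in>insert a (fst ` P). z \<in> T y e"
      using fin[of "insert a (fst ` P)" e] P a e0 by fastforce
    have "z \<in> T y r" if "(y, r) \<in> P" for y r
    proof -
      have "e \<le> r" unfolding e_def using P(2) that by (intro Min_le) force+
      moreover have "z \<in> T y e" using z that by force
      ultimately show ?thesis by (auto simp: T_def)
    qed
    then have "z \<in> \<Inter>\<G>" using P(3) by auto
    then show "\<Inter>\<G> \<noteq> {}" by blast
  qed
  then obtain z where z: "\<And>y e. y \<in> C \<Longrightarrow> e > 0 \<Longrightarrow> z \<in> T y e" by fastforce
  have zC: "z \<in> C" using z[OF a, of 1] by (simp add: T_def)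
  have g0: "g y z \<le> 0" if "y \<in> C" for y
    by (rule field_le_epsilon) (use z[OF that] in \<open>auto simp: T_def\<close>)
  have "k * F z y + inner (z - x) (y - z) \<ge> 0" if y: "y \<in> C" for y
  proof (rule minty[OF k _ zC _ y])
    show "continuous_on C (\<lambda>y. y - x)" by (intro continuous_intros)
    show "k * F y z + inner (y - x) (z - y) \<le> 0" if "y \<in> C" for y
    proof -
      have "q y z = inner (y - x) (z - y) + inner (z - y) (z - y)"
        by (simp add: q_def inner_simps)
      then show ?thesis using g0[OF that] inner_ge_zero[of "z - y"] unfolding g_def by linarith
    qed
  qed
  then show ?thesis using zC by (auto simp: resolvent_def)
qed

lemma resolvent_nonempty:
  assumes "k > 0" "d \<ge> 0"
  shows "resolvent C (\<lambda>u v. k * F u v) d x \<noteq> {}"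
proof -
  obtain z where z: "z \<in> resolvent C (\<lambda>u v. k * F u v) 0 x" using exact_resolvent_exists[OF assms(1)] by blast
  then have "z \<in> resolvent C (\<lambda>u v. k * F u v) d x" using assms(2) by (fastforce simp: resolvent_def)
  then show ?thesis by blast
qed

text \<open>Testing each of the two points in the inequality of the other and adding, monotonicity removes \<open>F\<close> and
  leaves \<open>|q - w|\<^sup>2 \<le> d + |y - y'| |q - w|\<close>.\<close>

lemma resolvent_error:
  assumes k: "k \<ge> 0" and d: "d \<ge> 0"
    and q: "q \<in> resolvent C (\<lambda>u v. k * F u v) d y"
    and w: "w \<in> resolvent C (\<lambda>u v. k * F u v) 0 y'"
  shows "norm (q - w) \<le> sqrt d + norm (y - y')"
proof (rule ccontr)
  assume "\<not> ?thesis"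
  then have n: "norm (q - w) > sqrt d + norm (y - y')" by simp
  have C: "q \<in> C" "w \<in> C" using q w by (auto simp: resolvent_def)
  have "k * F q w + inner (q - y) (w - q) \<ge> - d" "k * F w q + inner (w - y') (q - w) \<ge> 0"
    using q w by (auto simp: resolvent_def)
  moreover have "k * F q w + k * F w q \<le> 0"
    using mult_nonneg_nonpos[OF k F_mono[OF C]] by (simp add: algebra_simps)
  moreover have "inner (q - y) (w - q) + inner (w - y') (q - w)
      = inner (y - y') (q - w) - (norm (q - w))\<^sup>2"
    by (simp add: power2_norm_eq_inner inner_simps inner_commute)
  moreover have "inner (y - y') (q - w) \<le> norm (y - y') * norm (q - w)" by (rule norm_cauchy_schwarz)
  ultimately have le: "(norm (q - w))\<^sup>2 \<le> d + norm (y - y') * norm (q - w)" by linarith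
  have s: "sqrt d \<ge> 0" using d by simp
  have n': "norm (q - w) > sqrt d" using n norm_ge_zero[of "y - y'"] by linarith
  have "d + norm (y - y') * norm (q - w) \<le> sqrt d * norm (q - w) + norm (y - y') * norm (q - w)"
    using mult_left_mono[OF less_imp_le[OF n'] s] d by simp
  also have "\<dots> < norm (q - w) * norm (q - w)"
    unfolding distrib_right[symmetric] using n n' s by (intro mult_strict_right_mono) auto
  finally show False using le by (simp add: power2_eq_square)
qed

section \<open>The exact step and averaged projections\<close>

text \<open>The exact forward-backward-forward step. Monotonicity of \<open>F\<close> and of \<open>B\<close> shows that \<open>p\<close> lies beyond the
  hyperplane through \<open>w\<close> orthogonal to \<open>z - x\<close>, where \<open>z\<close> is the new point; the second forward step costs
  no more than \<open>(k * chi)\<^sup>2 |x - w|\<^sup>2\<close>.\<close>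

lemma tseng_step:
  assumes k: "k > 0" and B: "monotone_operator_on D B" "chi-lipschitz_on D B" and CD: "C \<subseteq> D"
    and x: "x \<in> D" and w: "w \<in> resolvent C (\<lambda>u v. k * F u v) 0 (x - k *\<^sub>R B x)"
    and p: "p \<in> C" "\<And>y. y \<in> C \<Longrightarrow> F p y + inner (B p) (y - p) \<ge> 0"
  shows "(norm (w + k *\<^sub>R (B x - B w) - p))\<^sup>2 \<le> (norm (x - p))\<^sup>2 - (1 - (k * chi)\<^sup>2) * (norm (x - w))\<^sup>2"
proof -
  define z where "z = w + k *\<^sub>R (B x - B w)"
  have wC: "w \<in> C" using w by (simp add: resolvent_def)
  have D: "w \<in> D" "p \<in> D" using CD wC p(1) by auto
  have "k * F w p + inner (w - (x - k *\<^sub>R B x)) (p - w) \<ge> 0" using w p(1) by (auto simp: resolvent_def)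
  moreover have "k * F p w + k * inner (B p) (w - p) \<ge> 0"
    using mult_nonneg_nonneg[OF less_imp_le[OF k] p(2)[OF wC]] by (simp add: distrib_left)
  moreover have "k * F w p + k * F p w \<le> 0"
    using mult_nonneg_nonpos[OF less_imp_le[OF k] F_mono[OF wC p(1)]] by (simp add: algebra_simps)
  moreover have "k * inner (w - p) (B w - B p) \<ge> 0"
    using k B(1) D by (auto simp: monotone_operator_on_def)
  moreover have "inner (w - (x - k *\<^sub>R B x)) (p - w) + k * inner (B p) (w - p) + k * inner (w - p) (B w - B p)
      = inner (z - x) (p - w)"
    by (simp add: z_def inner_simps inner_commute algebra_simps)
  ultimately have ge: "inner (z - x) (p - w) \<ge> 0" by linarith
  have "norm (B x - B w) \<le> chi * norm (x - w)"
    using lipschitz_onD[OF B(2) x D(1)] by (simp add: dist_norm)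
  then have "norm (z - w) \<le> k * chi * norm (x - w)"
    using k by (simp add: z_def)
  then have "(norm (z - w))\<^sup>2 \<le> (k * chi * norm (x - w))\<^sup>2" by (intro power_mono) auto
  moreover have "(norm (z - p))\<^sup>2 = (norm (x - p))\<^sup>2 - 2 * inner (z - x) (p - w)
      + (norm (z - w))\<^sup>2 - (norm (x - w))\<^sup>2"
    by (simp add: power2_norm_eq_inner inner_simps inner_commute)
  ultimately show ?thesis using ge unfolding z_def by (simp add: power_mult_distrib algebra_simps)
qed

end

text \<open>Jensen's inequality for the squared norm: the difference of the two sides is the weighted variance.\<close>

lemma norm_sq_weighted_average:
  fixes a :: "'i \<Rightarrow> 'a::real_inner"
  assumes c: "\<And>i. i \<in> J \<Longrightarrow> c i \<ge> 0" "sum c J = 1"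
  shows "(norm (\<Sum>i\<in>J. c i *\<^sub>R a i))\<^sup>2 \<le> (\<Sum>i\<in>J. c i * (norm (a i))\<^sup>2)"
proof -
  define m where "m = (\<Sum>i\<in>J. c i *\<^sub>R a i)"
  have "0 \<le> (\<Sum>i\<in>J. c i * (norm (a i - m))\<^sup>2)" using c by (intro sum_nonneg) auto
  also have "\<dots> = (\<Sum>i\<in>J. c i * (norm (a i))\<^sup>2 - 2 * inner (c i *\<^sub>R a i) m + c i * inner m m)"
    by (rule sum.cong) (auto simp: power2_norm_eq_inner inner_simps inner_commute algebra_simps)
  also have "\<dots> = (\<Sum>i\<in>J. c i * (norm (a i))\<^sup>2) - 2 * inner m m + sum c J * inner m m"
    by (simp add: sum.distrib sum_subtractf sum_distrib_left[symmetric] sum_distrib_right[symmetric]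
        inner_sum_left[symmetric] m_def del: inner_scaleR_left)
  finally show ?thesis using c(2) by (simp add: power2_norm_eq_inner m_def[symmetric])
qed

lemma projector_firm:
  fixes D :: "'a::{real_inner,complete_space} set"
  assumes D: "closed D" "convex D" "p \<in> D"
  shows "(norm (projector D x - p))\<^sup>2 \<le> (norm (x - p))\<^sup>2 - (norm (x - projector D x))\<^sup>2"
proof -
  have "(norm (x - p))\<^sup>2 = (norm (projector D x - p))\<^sup>2 + (norm (x - projector D x))\<^sup>2
      - 2 * inner (x - projector D x) (p - projector D x)"
    by (simp add: power2_norm_eq_inner inner_simps inner_commute)
  then show ?thesis using projector_obtuse[OF D, of x] by linarith
qed

lemma averaged_projections:
  fixes S :: "'i \<Rightarrow> 'a::{real_inner,complete_space} set" and p z :: 'a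
  assumes c: "\<And>i. i \<in> J \<Longrightarrow> c i \<ge> 0" "sum c J = 1"
    and S: "\<And>i. i \<in> J \<Longrightarrow> closed (S i)" "\<And>i. i \<in> J \<Longrightarrow> convex (S i)" "\<And>i. i \<in> J \<Longrightarrow> p \<in> S i"
  defines "V \<equiv> \<Sum>i\<in>J. c i * (norm (z - projector (S i) z))\<^sup>2"
  shows "(norm ((\<Sum>i\<in>J. c i *\<^sub>R projector (S i) z) - p))\<^sup>2 \<le> (norm (z - p))\<^sup>2 - V"
    and "(norm ((\<Sum>i\<in>J. c i *\<^sub>R projector (S i) z) - z))\<^sup>2 \<le> V"
proof -
  have shift: "(\<Sum>i\<in>J. c i *\<^sub>R (projector (S i) z - v)) = (\<Sum>i\<in>J. c i *\<^sub>R projector (S i) z) - v" for v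
    by (simp add: scaleR_right_diff_distrib sum_subtractf scaleR_left.sum[symmetric] c(2))
  have "(norm ((\<Sum>i\<in>J. c i *\<^sub>R projector (S i) z) - p))\<^sup>2
      \<le> (\<Sum>i\<in>J. c i * (norm (projector (S i) z - p))\<^sup>2)"
    using norm_sq_weighted_average[OF c, of "\<lambda>i. projector (S i) z - p"] by (simp add: shift)
  also have "\<dots> \<le> (\<Sum>i\<in>J. c i * ((norm (z - p))\<^sup>2 - (norm (z - projector (S i) z))\<^sup>2))"
    using c S by (intro sum_mono mult_left_mono projector_firm) auto
  also have "\<dots> = (norm (z - p))\<^sup>2 - V"
    by (simp add: V_def right_diff_distrib sum_subtractf sum_distrib_right[symmetric] c(2))
  finally show "(norm ((\<Sum>i\<in>J. c i *\<^sub>R projector (S i) z) - p))\<^sup>2 \<le> (norm (z - p))\<^sup>2 - V" .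
  show "(norm ((\<Sum>i\<in>J. c i *\<^sub>R projector (S i) z) - z))\<^sup>2 \<le> V"
    using norm_sq_weighted_average[OF c, of "\<lambda>i. projector (S i) z - z"]
    by (simp add: shift V_def norm_minus_commute)
qed

section \<open>Quasi-Fejer sequences and weak convergence\<close>

lemma quasi_fejer_convergent:
  fixes a \<eta> :: "nat \<Rightarrow> real"
  assumes step: "\<And>n. a (Suc n) \<le> a n + \<eta> n" and a: "\<And>n. a n \<ge> 0"
    and \<eta>: "summable \<eta>" "\<And>n. \<eta> n \<ge> 0"
  shows "convergent a"
proof -
  define b where "b n = a n - sum \<eta> {..<n}" for n
  have "decseq b" unfolding decseq_Suc_iff b_def using step by (simp add: algebra_simps)
  moreover have "b n \<ge> - suminf \<eta>" for n
    using sum_le_suminf[OF \<eta>(1), of "{..<n}"] \<eta>(2) a[of n] by (simp add: b_def)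
  ultimately have "convergent b" using decseq_convergent unfolding convergent_def by metis
  then have "convergent (\<lambda>n. b n + sum \<eta> {..<n})"
    using \<eta>(1) by (intro convergent_add) (simp_all add: summable_iff_convergent)
  then show ?thesis by (simp add: b_def)
qed

text \<open>If \<open>l\<close> and \<open>l'\<close> are cluster points along two filters, \<open>\<langle>x n | l - l'\<rangle>\<close> is a combination of the squared
  distances to \<open>l\<close> and \<open>l'\<close> and therefore converges. Both \<open>\<langle>l | l - l'\<rangle>\<close> and \<open>\<langle>l' | l - l'\<rangle>\<close> equal
  its limit, so \<open>l = l'\<close>. If the sequence did not converge weakly, a second cluster point would arise along a
  filter that keeps it away from \<open>l\<close> in some direction.\<close>

lemma opial:
  fixes x :: "nat \<Rightarrow> 'a::{real_inner,complete_space}"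
  assumes Z: "Z \<noteq> {}" and dist: "\<And>p. p \<in> Z \<Longrightarrow> convergent (\<lambda>n. norm (x n - p))"
    and cluster: "\<And>G p. G \<le> sequentially \<Longrightarrow> G \<noteq> bot \<Longrightarrow>
      (\<And>u. ((\<lambda>n. inner (x n) u) \<longlongrightarrow> inner p u) G) \<Longrightarrow> p \<in> Z"
  shows "\<exists>l\<in>Z. weakly_converges x l"
proof -
  obtain a where a: "a \<in> Z" using Z by blast
  obtain K where K: "\<And>n. norm (norm (x n - a)) \<le> K"
    using convergent_imp_Bseq[OF dist[OF a]] by (auto simp: Bseq_def)
  have bdd: "norm (x n) \<le> K + norm a" for n
    using K[of n] norm_triangle_ineq2[of "x n" a] by simp
  obtain G l where G: "G \<le> sequentially" "G \<noteq> bot" and l: "\<And>u. ((\<lambda>n. inner (x n) u) \<longlongrightarrow> inner l u) G"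
    using bounded_weak_cluster_filter[of x, OF bdd sequentially_bot] by blast
  have lZ: "l \<in> Z" by (rule cluster[OF G l])
  have "(\<lambda>n. inner (x n) u) \<longlonglongrightarrow> inner l u" for u
  proof (rule ccontr)
    assume "\<not> ?thesis"
    then obtain e where e: "e > 0" "\<not> eventually (\<lambda>n. dist (inner (x n) u) (inner l u) < e) sequentially"
      by (auto simp: tendsto_iff)
    define far where "far = {n. \<not> dist (inner (x n) u) (inner l u) < e}"
    define H where "H = inf sequentially (principal far)"
    have "H \<noteq> bot"
      using e(2) unfolding H_def far_def trivial_limit_def eventually_inf_principal by simp
    then obtain G' l' where G': "G' \<le> H" "G' \<noteq> bot"
      and l': "\<And>u. ((\<lambda>n. inner (x n) u) \<longlongrightarrow> inner l' u) G'"
      using bounded_weak_cluster_filter[of x, OF bdd \<open>H \<noteq> bot\<close>] by blast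
    have G's: "G' \<le> sequentially" using G'(1) unfolding H_def by (meson inf.boundedE)
    have l'Z: "l' \<in> Z" by (rule cluster[OF G's G'(2) l'])
    have "convergent (\<lambda>n. ((norm (x n - l'))\<^sup>2 - (norm (x n - l))\<^sup>2 + (norm l)\<^sup>2 - (norm l')\<^sup>2) / 2)"
    proof -
      obtain r r' where "(\<lambda>n. norm (x n - l)) \<longlonglongrightarrow> r" "(\<lambda>n. norm (x n - l')) \<longlonglongrightarrow> r'"
        using dist[OF lZ] dist[OF l'Z] unfolding convergent_def by blast
      then have "(\<lambda>n. ((norm (x n - l'))\<^sup>2 - (norm (x n - l))\<^sup>2 + (norm l)\<^sup>2 - (norm l')\<^sup>2) / 2)
          \<longlonglongrightarrow> (r'\<^sup>2 - r\<^sup>2 + (norm l)\<^sup>2 - (norm l')\<^sup>2) / 2"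
        by (intro tendsto_intros) auto
      then show ?thesis by (rule convergentI)
    qed
    moreover have "((norm (x n - l'))\<^sup>2 - (norm (x n - l))\<^sup>2 + (norm l)\<^sup>2 - (norm l')\<^sup>2) / 2
        = inner (x n) (l - l')" for n
      by (simp add: power2_norm_eq_inner inner_simps inner_commute)
    ultimately obtain c where c: "(\<lambda>n. inner (x n) (l - l')) \<longlonglongrightarrow> c" by (auto simp: convergent_def)
    have "inner l (l - l') = c"
      using tendsto_unique[OF G(2) l tendsto_mono[OF G(1) c]] .
    moreover have "inner l' (l - l') = c"
      using tendsto_unique[OF G'(2) l' tendsto_mono[OF G's c]] .
    ultimately have "inner (l - l') (l - l') = 0" by (simp add: inner_diff_left)
    then have "l' = l" by simp
    then have "eventually (\<lambda>n. dist (inner (x n) u) (inner l u) < e) G'"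
      using tendstoD[OF l'[of u] e(1)] by simp
    moreover have "eventually (\<lambda>n. n \<in> far) G'"
      by (rule filter_leD[OF G'(1)]) (simp add: H_def eventually_inf_principal)
    ultimately have "eventually (\<lambda>n. False) G'"
      by eventually_elim (simp add: far_def)
    then show False using G'(2) by (simp add: trivial_limit_def)
  qed
  then show ?thesis using lZ by (auto simp: weakly_converges_def)
qed

section \<open>The perturbed iteration\<close>

context equilibrium_bifunction
begin

text \<open>One step of the routine in terms of the exact resolvent \<open>w\<close>. The error \<open>k e1\<close> enters the argument of the
  resolvent, so \<open>q - w\<close> has norm at most \<open>sqrt d + k |e1|\<close>; since \<open>k * chi \<le> 1\<close>, the second forward step at
  most doubles this, and the errors \<open>k e1\<close> and \<open>k e2\<close> are added once more.\<close>

lemma routine_step_perturbation: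
  assumes step: "routine_step D B C F S J c k d e1 e2 x x'"
    and k: "k > 0" "k * chi \<le> 1" and d: "d \<ge> 0"
    and B: "chi-lipschitz_on D B" and CD: "C \<subseteq> D"
  shows "\<exists>w z. w \<in> resolvent C (\<lambda>u v. k * F u v) 0 (x - k *\<^sub>R B x) \<and>
     norm (z - (w + k *\<^sub>R (B x - B w))) \<le> 2 * sqrt d + 3 * (k * norm e1) + k * norm e2 \<and>
     x' = (\<Sum>i\<in>J. c i *\<^sub>R projector (S i) z)"
proof -
  obtain q z where xD: "x \<in> D" and qD: "q \<in> D"
    and q: "q \<in> resolvent C (\<lambda>u v. k * F u v) d (x - k *\<^sub>R (B x + e1))"
    and z: "z = x - (x - k *\<^sub>R (B x + e1)) + (q - k *\<^sub>R (B q + e2))"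
    and x': "x' = (\<Sum>i\<in>J. c i *\<^sub>R projector (S i) z)"
    using step unfolding routine_step_def by blast
  obtain w where w: "w \<in> resolvent C (\<lambda>u v. k * F u v) 0 (x - k *\<^sub>R B x)"
    using exact_resolvent_exists[OF k(1)] by blast
  have wD: "w \<in> D" using w CD by (auto simp: resolvent_def)
  have "norm (q - w) \<le> sqrt d + norm (x - k *\<^sub>R (B x + e1) - (x - k *\<^sub>R B x))"
    using k d by (intro resolvent_error[OF _ _ q w]) auto
  also have "x - k *\<^sub>R (B x + e1) - (x - k *\<^sub>R B x) = - (k *\<^sub>R e1)" by (simp add: algebra_simps)
  finally have qw: "norm (q - w) \<le> sqrt d + k * norm e1" using k by simp
  have "norm (k *\<^sub>R (B q - B w)) \<le> k * (chi * norm (q - w))"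
    using lipschitz_onD[OF B qD wD] k by (simp add: dist_norm)
  also have "\<dots> \<le> norm (q - w)"
    using mult_right_mono[OF k(2) norm_ge_zero[of "q - w"]] by (simp add: mult.assoc)
  finally have Bqw: "norm (k *\<^sub>R (B q - B w)) \<le> norm (q - w)" .
  have "z - (w + k *\<^sub>R (B x - B w)) = (q - w) - k *\<^sub>R (B q - B w) + (k *\<^sub>R e1 - k *\<^sub>R e2)"
    by (simp add: z algebra_simps)
  also have "norm \<dots> \<le> norm (q - w) + norm (k *\<^sub>R (B q - B w)) + (norm (k *\<^sub>R e1) + norm (k *\<^sub>R e2))"
    by (intro norm_triangle_mono norm_triangle_ineq4)
  also have "\<dots> \<le> 2 * sqrt d + 3 * (k * norm e1) + k * norm e2"
    using qw Bqw k by simp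
  finally show ?thesis using w x' by blast
qed

end

text \<open>The run of the routine after all errors have been collected in \<open>\<eta>\<close>: \<open>w n\<close> is the exact resolvent, and \<open>z n\<close> is
  the point that is projected.\<close>

locale perturbed_iteration = equilibrium_bifunction C F
  for C :: "'a::{real_inner,complete_space} set" and F +
  fixes D :: "'a set" and B :: "'a \<Rightarrow> 'a" and chi \<epsilon> :: real
    and I :: "'i set" and S :: "'i \<Rightarrow> 'a set" and In :: "nat \<Rightarrow> 'i set" and M :: "'i \<Rightarrow> nat"
    and \<omega> :: "'i \<Rightarrow> nat \<Rightarrow> real" and \<gamma> \<eta> :: "nat \<Rightarrow> real" and x w z :: "nat \<Rightarrow> 'a"
  assumes B_mono: "monotone_operator_on D B" and B_lip: "chi-lipschitz_on D B"
    and C_dom: "C \<subseteq> D"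
    and S_closed: "i \<in> I \<Longrightarrow> closed (S i)" and S_convex: "i \<in> I \<Longrightarrow> convex (S i)"
    and solutions_nonempty: "solutions (\<Inter>i\<in>I. S i) C F B \<noteq> {}"
    and In_sub: "In n \<subseteq> I" and In_finite: "finite (In n)"
    and control: "i \<in> I \<Longrightarrow> \<exists>k\<in>{n..n + M i}. i \<in> In k"
    and eps_pos: "\<epsilon> > 0"
    and omega: "i \<in> In n \<Longrightarrow> \<omega> i n \<ge> \<epsilon>" "(\<Sum>i\<in>In n. \<omega> i n) = 1"
    and gamma: "\<gamma> n \<ge> \<epsilon>" "\<gamma> n * chi \<le> 1 - \<epsilon>"
    and x_dom: "x n \<in> D"
    and w: "w n \<in> resolvent C (\<lambda>u v. \<gamma> n * F u v) 0 (x n - \<gamma> n *\<^sub>R B (x n))"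
    and z: "norm (z n - (w n + \<gamma> n *\<^sub>R (B (x n) - B (w n)))) \<le> \<eta> n"
    and x_Suc: "x (Suc n) = (\<Sum>i\<in>In n. \<omega> i n *\<^sub>R projector (S i) (z n))"
    and eta_summable: "summable \<eta>"
begin

definition Sol where "Sol = solutions (\<Inter>i\<in>I. S i) C F B"

definition projection_gap where "projection_gap n = (\<Sum>i\<in>In n. \<omega> i n * (norm (z n - projector (S i) (z n)))\<^sup>2)"

lemma gamma_pos: "\<gamma> n > 0" using gamma(1)[of n] eps_pos by linarith

lemma w_C: "w n \<in> C" using w[of n] by (simp add: resolvent_def)

lemma chi_nonneg: "chi \<ge> 0" using B_lip by (rule lipschitz_on_nonneg)

lemma eta_nonneg: "\<eta> n \<ge> 0" by (rule order_trans[OF norm_ge_zero z])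

lemma eta_lim: "\<eta> \<longlonglongrightarrow> 0" by (rule summable_LIMSEQ_zero[OF eta_summable])

lemma omega_nonneg: "i \<in> In n \<Longrightarrow> \<omega> i n \<ge> 0" using omega(1)[of i n] eps_pos by linarith

lemma projection_gap_nonneg: "projection_gap n \<ge> 0"
  unfolding projection_gap_def by (intro sum_nonneg mult_nonneg_nonneg omega_nonneg) auto

text \<open>The first part makes the sequence quasi-Fejer with respect to the solutions; the second shows
  what each step gains, so that the gains vanish once the distances converge.\<close>

lemma descent:
  assumes p: "p \<in> Sol"
  shows "norm (x (Suc n) - p) \<le> norm (x n - p) + \<eta> n"
    and "\<epsilon> * (norm (x n - w n))\<^sup>2 + projection_gap n
      \<le> (norm (x n - p))\<^sup>2 - (norm (x (Suc n) - p))\<^sup>2 + 2 * \<eta> n * norm (x n - p) + (\<eta> n)\<^sup>2"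
proof -
  have pC: "p \<in> C" and pS: "\<And>i. i \<in> I \<Longrightarrow> p \<in> S i"
    and psol: "\<And>y. y \<in> C \<Longrightarrow> F p y + inner (B p) (y - p) \<ge> 0"
    using p by (auto simp: Sol_def solutions_def)
  define t where "t = w n + \<gamma> n *\<^sub>R (B (x n) - B (w n))"
  have "(norm (t - p))\<^sup>2 \<le> (norm (x n - p))\<^sup>2 - (1 - (\<gamma> n * chi)\<^sup>2) * (norm (x n - w n))\<^sup>2"
    unfolding t_def
    by (rule tseng_step[OF gamma_pos B_mono B_lip C_dom x_dom w pC psol])
  moreover have "(\<gamma> n * chi)\<^sup>2 \<le> 1 - \<epsilon>"
  proof -
    have g: "0 \<le> \<gamma> n * chi" using gamma_pos[of n] chi_nonneg by simp
    have "(\<gamma> n * chi) * (\<gamma> n * chi) \<le> (\<gamma> n * chi) * 1"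
      using gamma(2)[of n] eps_pos g by (intro mult_left_mono) auto
    then show ?thesis using gamma(2)[of n] by (simp add: power2_eq_square)
  qed
  then have "\<epsilon> * (norm (x n - w n))\<^sup>2 \<le> (1 - (\<gamma> n * chi)\<^sup>2) * (norm (x n - w n))\<^sup>2"
    by (intro mult_right_mono) auto
  ultimately have t: "(norm (t - p))\<^sup>2 \<le> (norm (x n - p))\<^sup>2 - \<epsilon> * (norm (x n - w n))\<^sup>2" by linarith
  then have "(norm (t - p))\<^sup>2 \<le> (norm (x n - p))\<^sup>2" using eps_pos by (smt (verit) mult_nonneg_nonneg zero_le_power2)
  then have tx: "norm (t - p) \<le> norm (x n - p)" by (rule power2_le_imp_le) simp
  have "norm (z n - p) \<le> norm (z n - t) + norm (t - p)"
    using norm_triangle_ineq[of "z n - t" "t - p"] by simp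
  then have zt: "norm (z n - p) \<le> norm (t - p) + \<eta> n" using z[of n] by (simp add: t_def)
  have avg: "(norm (x (Suc n) - p))\<^sup>2 \<le> (norm (z n - p))\<^sup>2 - projection_gap n"
    unfolding x_Suc projection_gap_def
    using In_sub[of n] S_closed S_convex pS omega(2) omega_nonneg
    by (intro averaged_projections(1)) blast+
  then have "(norm (x (Suc n) - p))\<^sup>2 \<le> (norm (z n - p))\<^sup>2" using projection_gap_nonneg[of n] by linarith
  then have "norm (x (Suc n) - p) \<le> norm (z n - p)" by (rule power2_le_imp_le) simp
  then show "norm (x (Suc n) - p) \<le> norm (x n - p) + \<eta> n" using zt tx by linarith
  have "(norm (z n - p))\<^sup>2 \<le> (norm (t - p) + \<eta> n)\<^sup>2" using zt by (intro power_mono) auto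
  also have "\<dots> = (norm (t - p))\<^sup>2 + 2 * \<eta> n * norm (t - p) + (\<eta> n)\<^sup>2"
    by (simp add: power2_eq_square algebra_simps)
  also have "\<dots> \<le> (norm (t - p))\<^sup>2 + 2 * \<eta> n * norm (x n - p) + (\<eta> n)\<^sup>2"
    using tx eta_nonneg by (intro add_right_mono add_left_mono mult_left_mono) auto
  finally show "\<epsilon> * (norm (x n - w n))\<^sup>2 + projection_gap n
      \<le> (norm (x n - p))\<^sup>2 - (norm (x (Suc n) - p))\<^sup>2 + 2 * \<eta> n * norm (x n - p) + (\<eta> n)\<^sup>2"
    using avg t by linarith
qed

lemma distance_convergent:
  assumes "p \<in> Sol" shows "convergent (\<lambda>n. norm (x n - p))"
proof (rule quasi_fejer_convergent)
  show "norm (x (Suc n) - p) \<le> norm (x n - p) + \<eta> n" for n by (rule descent(1)[OF assms])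
  show "summable \<eta>" "\<eta> n \<ge> 0" for n by (fact eta_summable eta_nonneg)+
qed simp

lemma gap_vanishes: "(\<lambda>n. \<epsilon> * (norm (x n - w n))\<^sup>2 + projection_gap n) \<longlonglongrightarrow> 0"
proof -
  obtain p where p: "p \<in> Sol" using solutions_nonempty by (auto simp: Sol_def)
  obtain L where L: "(\<lambda>n. norm (x n - p)) \<longlonglongrightarrow> L"
    using distance_convergent[OF p] by (auto simp: convergent_def)
  have "(\<lambda>n. (norm (x n - p))\<^sup>2 - (norm (x (Suc n) - p))\<^sup>2 + 2 * \<eta> n * norm (x n - p) + (\<eta> n)\<^sup>2)
      \<longlonglongrightarrow> L\<^sup>2 - L\<^sup>2 + 2 * 0 * L + 0\<^sup>2"
    by (intro tendsto_intros L LIMSEQ_Suc[OF L] eta_lim)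
  then have "(\<lambda>n. (norm (x n - p))\<^sup>2 - (norm (x (Suc n) - p))\<^sup>2 + 2 * \<eta> n * norm (x n - p) + (\<eta> n)\<^sup>2)
      \<longlonglongrightarrow> 0" by simp
  from tendsto_sandwich[OF _ _ tendsto_const this] show ?thesis
    using descent(2)[OF p] projection_gap_nonneg eps_pos by (simp add: always_eventually)
qed

lemma projection_gap_vanishes: "projection_gap \<longlonglongrightarrow> 0"
  by (rule tendsto_sandwich[OF _ _ tendsto_const gap_vanishes])
    (use projection_gap_nonneg eps_pos in \<open>simp_all add: always_eventually\<close>)

lemma x_minus_w: "(\<lambda>n. x n - w n) \<longlonglongrightarrow> 0"
proof -
  have "(\<lambda>n. \<epsilon> * (norm (x n - w n))\<^sup>2) \<longlonglongrightarrow> 0"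
    by (rule tendsto_sandwich[OF _ _ tendsto_const gap_vanishes])
      (use projection_gap_nonneg eps_pos in \<open>simp_all add: always_eventually\<close>)
  then have "(\<lambda>n. \<epsilon> * (norm (x n - w n))\<^sup>2 / \<epsilon>) \<longlonglongrightarrow> 0 / \<epsilon>"
    using eps_pos by (intro tendsto_divide tendsto_const) auto
  then show ?thesis using eps_pos by (simp add: tendsto_norm_zero_iff)
qed

lemma z_minus_x: "(\<lambda>n. z n - x n) \<longlonglongrightarrow> 0"
proof (rule Lim_null_comparison)
  have "(\<lambda>n. \<eta> n + 2 * norm (x n - w n)) \<longlonglongrightarrow> 0 + 2 * norm (0::'a)"
    by (intro tendsto_intros eta_lim x_minus_w)
  then show "(\<lambda>n. \<eta> n + 2 * norm (x n - w n)) \<longlonglongrightarrow> 0" by simp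
  show "eventually (\<lambda>n. norm (z n - x n) \<le> \<eta> n + 2 * norm (x n - w n)) sequentially"
  proof (intro always_eventually allI)
    fix n
    have "norm (\<gamma> n *\<^sub>R (B (x n) - B (w n))) \<le> \<gamma> n * (chi * norm (x n - w n))"
      using lipschitz_onD[OF B_lip x_dom, of "w n" n] w_C[of n] C_dom gamma_pos[of n]
      by (auto simp: dist_norm)
    also have "\<dots> \<le> 1 * norm (x n - w n)"
      unfolding mult.assoc[symmetric] using gamma(2)[of n] eps_pos by (intro mult_right_mono) auto
    finally have "norm (\<gamma> n *\<^sub>R (B (x n) - B (w n))) \<le> norm (x n - w n)" by simp
    moreover have "z n - x n = (z n - (w n + \<gamma> n *\<^sub>R (B (x n) - B (w n)))) - (x n - w n)
        + \<gamma> n *\<^sub>R (B (x n) - B (w n))" by simp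
    then have "norm (z n - x n) \<le> norm (z n - (w n + \<gamma> n *\<^sub>R (B (x n) - B (w n))))
        + norm (x n - w n) + norm (\<gamma> n *\<^sub>R (B (x n) - B (w n)))"
      by (metis norm_triangle_mono norm_triangle_ineq4 order_refl)
    ultimately show "norm (z n - x n) \<le> \<eta> n + 2 * norm (x n - w n)" using z[of n] by linarith
  qed
qed

lemma successive_difference: "(\<lambda>n. x (Suc n) - x n) \<longlonglongrightarrow> 0"
proof -
  obtain p where p: "p \<in> Sol" using solutions_nonempty by (auto simp: Sol_def)
  have pS: "p \<in> S i" if "i \<in> I" for i using p that by (auto simp: Sol_def solutions_def)
  have le: "(norm (x (Suc n) - z n))\<^sup>2 \<le> projection_gap n" for n
    unfolding x_Suc projection_gap_def
    using In_sub[of n] S_closed S_convex pS omega(2) omega_nonneg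
    by (intro averaged_projections(2)) blast+
  have "(\<lambda>n. (norm (x (Suc n) - z n))\<^sup>2) \<longlonglongrightarrow> 0"
    by (rule tendsto_sandwich[OF _ _ tendsto_const projection_gap_vanishes]) (simp_all add: always_eventually le)
  then have "(\<lambda>n. x (Suc n) - z n) \<longlonglongrightarrow> 0" by (simp add: tendsto_norm_zero_iff)
  from tendsto_add[OF this z_minus_x] show ?thesis by simp
qed

text \<open>Successive differences tend to zero, and hence so do differences over at most \<open>m\<close> steps. This is where the control
  condition, with its bounded waiting times \<open>M i\<close>, matters.\<close>

lemma finite_shift_difference:
  assumes k: "\<And>n. n \<le> k n" "\<And>n. k n \<le> n + m"
  shows "(\<lambda>n. x n - x (k n)) \<longlonglongrightarrow> 0"
proof (rule Lim_null_comparison)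
  have "(\<lambda>n. \<Sum>j<m. norm (x (Suc (n + j)) - x (n + j))) \<longlonglongrightarrow> (\<Sum>j<m. norm (0::'a))"
    using LIMSEQ_ignore_initial_segment[OF successive_difference]
    by (intro tendsto_sum tendsto_norm) simp
  then show "(\<lambda>n. \<Sum>j<m. norm (x (Suc (n + j)) - x (n + j))) \<longlonglongrightarrow> 0" by simp
  show "eventually (\<lambda>n. norm (x n - x (k n)) \<le> (\<Sum>j<m. norm (x (Suc (n + j)) - x (n + j)))) sequentially"
  proof (intro always_eventually allI)
    fix n
    define l where "l = k n - n"
    have l: "k n = n + l" "l \<le> m" using k[of n] by (auto simp: l_def)
    have "(\<Sum>j<l. x (Suc (n + j)) - x (n + j)) = x (n + l) - x n"
      using sum_lessThan_telescope[of "\<lambda>j. x (n + j)" l] by simp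
    then have "norm (x n - x (k n)) \<le> (\<Sum>j<l. norm (x (Suc (n + j)) - x (n + j)))"
      using norm_sum[of "\<lambda>j. x (Suc (n + j)) - x (n + j)" "{..<l}"] l(1)
      by (simp add: norm_minus_commute)
    also have "\<dots> \<le> (\<Sum>j<m. norm (x (Suc (n + j)) - x (n + j)))"
      using l(2) by (intro sum_mono2) auto
    finally show "norm (x n - x (k n)) \<le> (\<Sum>j<m. norm (x (Suc (n + j)) - x (n + j)))" .
  qed
qed

text \<open>Within \<open>M i\<close> steps after \<open>n\<close> comes an iteration that uses \<open>S i\<close>. Its projection is close to its iterate
  since the weight of \<open>S i\<close> is at least \<open>\<epsilon>\<close>, and that iterate is close to \<open>x n\<close>.\<close>

lemma approaches_each_set:
  assumes i: "i \<in> I"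
  shows "\<exists>s. (\<forall>n. s n \<in> S i) \<and> (\<lambda>n. x n - s n) \<longlonglongrightarrow> 0"
proof -
  have ne: "S i \<noteq> {}" using solutions_nonempty i by (auto simp: solutions_def)
  obtain k where k: "\<And>n. n \<le> k n" "\<And>n. k n \<le> n + M i" "\<And>n. i \<in> In (k n)"
    using control[OF i] by (metis atLeastAtMost_iff)
  have k_lim: "filterlim k sequentially sequentially"
    by (rule filterlim_at_top_mono[OF filterlim_ident]) (simp add: k(1))
  have le: "\<epsilon> * (norm (z n - projector (S i) (z n)))\<^sup>2 \<le> projection_gap n" if "i \<in> In n" for n
  proof -
    have "\<epsilon> * (norm (z n - projector (S i) (z n)))\<^sup>2 \<le> \<omega> i n * (norm (z n - projector (S i) (z n)))\<^sup>2"
      using omega(1)[OF that] by (intro mult_right_mono) auto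
    also have "\<dots> \<le> projection_gap n"
      unfolding projection_gap_def using that omega_nonneg In_finite
      by (intro member_le_sum[where f = "\<lambda>i. \<omega> i n * (norm (z n - projector (S i) (z n)))\<^sup>2"]) auto
    finally show ?thesis .
  qed
  have "(\<lambda>n. projection_gap (k n) / \<epsilon>) \<longlonglongrightarrow> 0 / \<epsilon>"
    using eps_pos by (intro tendsto_divide tendsto_const filterlim_compose[OF projection_gap_vanishes k_lim]) auto
  then have gap0: "(\<lambda>n. projection_gap (k n) / \<epsilon>) \<longlonglongrightarrow> 0" by simp
  have "(\<lambda>n. (norm (z (k n) - projector (S i) (z (k n))))\<^sup>2) \<longlonglongrightarrow> 0"
    by (rule tendsto_sandwich[OF _ _ tendsto_const gap0])
      (use le[OF k(3)] eps_pos in \<open>simp_all add: always_eventually field_simps\<close>)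
  then have 3: "(\<lambda>n. z (k n) - projector (S i) (z (k n))) \<longlonglongrightarrow> 0" by (simp add: tendsto_norm_zero_iff)
  have 2: "(\<lambda>n. z (k n) - x (k n)) \<longlonglongrightarrow> 0" by (rule filterlim_compose[OF z_minus_x k_lim])
  have 1: "(\<lambda>n. x n - x (k n)) \<longlonglongrightarrow> 0" by (rule finite_shift_difference[OF k(1,2)])
  from tendsto_add[OF tendsto_diff[OF 1 2] 3]
  have "(\<lambda>n. x n - projector (S i) (z (k n))) \<longlonglongrightarrow> 0" by simp
  then show ?thesis
    by (intro exI[of _ "\<lambda>n. projector (S i) (z (k n))"] conjI allI
        projector_in[OF S_closed[OF i] S_convex[OF i] ne])
qed

text \<open>The dual inequality holds at \<open>w n\<close> up to an error proportional to \<open>|x n - w n|\<close>. The left side may have either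
  sign, and the step size is replaced by its lower bound \<open>\<epsilon>\<close> only where it is nonnegative.\<close>

lemma variational_gap:
  assumes y: "y \<in> C"
  shows "\<epsilon> * (F y (w n) + inner (B y) (w n - y)) \<le> 2 * norm (x n - w n) * norm (y - w n)"
proof -
  let ?d = "norm (x n - w n) * norm (y - w n)"
  have D: "w n \<in> D" "y \<in> D" using w_C y C_dom by auto
  have "\<gamma> n * F (w n) y + inner (w n - (x n - \<gamma> n *\<^sub>R B (x n))) (y - w n) \<ge> 0"
    using w[of n] y by (auto simp: resolvent_def)
  moreover have "\<gamma> n * F y (w n) + \<gamma> n * F (w n) y \<le> 0"
    using mult_nonneg_nonpos[OF less_imp_le[OF gamma_pos] F_mono[OF y w_C]] by (simp add: algebra_simps)
  moreover have "\<gamma> n * inner (y - w n) (B y - B (w n)) \<ge> 0"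
    using gamma_pos[of n] B_mono D by (auto simp: monotone_operator_on_def)
  moreover have "inner (w n - (x n - \<gamma> n *\<^sub>R B (x n))) (y - w n)
      = \<gamma> n * inner (B (x n) - B (w n)) (y - w n) - inner (x n - w n) (y - w n)
        - \<gamma> n * inner (B y) (w n - y) - \<gamma> n * inner (y - w n) (B y - B (w n))"
    by (simp add: inner_simps inner_commute algebra_simps)
  moreover have "- inner (x n - w n) (y - w n) \<le> ?d"
    using Cauchy_Schwarz_ineq2[of "x n - w n" "y - w n"] by linarith
  moreover have "\<gamma> n * inner (B (x n) - B (w n)) (y - w n) \<le> ?d"
  proof -
    have "inner (B (x n) - B (w n)) (y - w n) \<le> norm (B (x n) - B (w n)) * norm (y - w n)"
      by (rule norm_cauchy_schwarz)
    also have "\<dots> \<le> (chi * norm (x n - w n)) * norm (y - w n)"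
      using lipschitz_onD[OF B_lip x_dom D(1)] by (intro mult_right_mono) (auto simp: dist_norm)
    finally have "\<gamma> n * inner (B (x n) - B (w n)) (y - w n) \<le> (\<gamma> n * chi) * ?d"
      using gamma_pos[of n] by (simp add: mult.assoc)
    also have "\<dots> \<le> 1 * ?d" using gamma(2)[of n] eps_pos by (intro mult_right_mono) auto
    finally show ?thesis by simp
  qed
  ultimately have *: "\<gamma> n * (F y (w n) + inner (B y) (w n - y)) \<le> 2 * ?d"
    unfolding distrib_left by linarith
  show ?thesis
  proof (cases "F y (w n) + inner (B y) (w n - y) \<ge> 0")
    case True
    from mult_right_mono[OF gamma(1)[of n] True] * show ?thesis by simp
  next
    case False
    then have "\<epsilon> * (F y (w n) + inner (B y) (w n - y)) \<le> 0" using eps_pos by (simp add: mult_nonneg_nonpos)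
    also have "0 \<le> 2 * norm (x n - w n) * norm (y - w n)" by simp
    finally show ?thesis .
  qed
qed

text \<open>\<open>x n\<close>, \<open>w n\<close> and the points of \<open>S i\<close> near \<open>x n\<close> have the same weak cluster points. Closed convex sets contain
  them; for the dual inequality these are the sublevel sets in which \<open>w n\<close> eventually lies.\<close>

lemma cluster_point_solves:
  assumes G: "G \<le> sequentially" "G \<noteq> bot"
    and lim: "\<And>u. ((\<lambda>n. inner (x n) u) \<longlongrightarrow> inner p u) G"
  shows "p \<in> Sol"
proof -
  have transfer: "((\<lambda>n. inner (s n) u) \<longlongrightarrow> inner p u) G" if "(\<lambda>n. x n - s n) \<longlonglongrightarrow> 0" for s u
  proof -
    have "((\<lambda>n. inner (x n) u - inner (x n - s n) u) \<longlongrightarrow> inner p u - inner 0 u) G"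
      by (intro tendsto_diff lim tendsto_inner tendsto_const tendsto_mono[OF G(1) that])
    then show ?thesis by (simp add: inner_diff_left)
  qed
  have pS: "p \<in> S i" if i: "i \<in> I" for i
  proof -
    obtain s where s: "\<And>n. s n \<in> S i" "(\<lambda>n. x n - s n) \<longlonglongrightarrow> 0" using approaches_each_set[OF i] by blast
    show ?thesis
      by (rule closed_convex_weakly_closed[OF S_closed[OF i] S_convex[OF i] G(2) _ transfer[OF s(2)]])
        (simp add: s(1))
  qed
  have pC: "p \<in> C"
    by (rule closed_convex_weakly_closed[OF C_closed C_convex G(2) _ transfer[OF x_minus_w]])
      (simp add: w_C)
  have le: "1 * F y p + inner (B y) (p - y) \<le> 0" if y: "y \<in> C" for y
  proof (rule field_le_epsilon)
    fix e :: real assume e: "e > 0"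
    define g where "g v = inner (B y) (v - y)" for v
    define err where "err n = 2 * norm (x n - w n) * norm (y - w n)" for n
    obtain q where q: "q \<in> Sol" using solutions_nonempty by (auto simp: Sol_def)
    obtain L where L: "(\<lambda>n. norm (x n - q)) \<longlonglongrightarrow> L"
      using distance_convergent[OF q] by (auto simp: convergent_def)
    have "err \<longlonglongrightarrow> 0"
    proof (rule Lim_null_comparison)
      have "(\<lambda>n. 2 * norm (x n - w n) * (norm (y - q) + norm (x n - q) + norm (x n - w n)))
          \<longlonglongrightarrow> 2 * norm (0::'a) * (norm (y - q) + L + norm (0::'a))"
        by (intro tendsto_intros L x_minus_w)
      then show "(\<lambda>n. 2 * norm (x n - w n) * (norm (y - q) + norm (x n - q) + norm (x n - w n))) \<longlonglongrightarrow> 0"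
        by simp
      have "norm (y - w n) \<le> norm (y - q) + norm (x n - q) + norm (x n - w n)" for n
        using norm_triangle_ineq[of "y - q - (x n - q)" "x n - w n"] norm_triangle_ineq4[of "y - q" "x n - q"]
        by simp
      then show "eventually (\<lambda>n. norm (err n)
          \<le> 2 * norm (x n - w n) * (norm (y - q) + norm (x n - q) + norm (x n - w n))) sequentially"
        by (intro always_eventually allI) (simp add: err_def mult_left_mono abs_mult)
    qed
    then have "eventually (\<lambda>n. err n < \<epsilon> * e) sequentially"
      using order_tendstoD(2) e eps_pos by fastforce
    then have "eventually (\<lambda>n. w n \<in> {v \<in> C. 1 * F y v + g v \<le> e}) sequentially"
    proof eventually_elim
      case (elim n)
      then have "\<epsilon> * (F y (w n) + g (w n)) \<le> \<epsilon> * e"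
        using variational_gap[OF y, of n] by (simp add: err_def g_def)
      then show ?case using eps_pos w_C by simp
    qed
    then have "eventually (\<lambda>n. w n \<in> {v \<in> C. 1 * F y v + g v \<le> e}) G" by (rule filter_leD[OF G(1)])
    moreover have "continuous_on UNIV g" unfolding g_def by (intro continuous_intros)
    moreover have "convex_on C g"
      by (rule convex_onI[OF _ C_convex]) (simp add: g_def inner_simps algebra_simps)
    ultimately have "p \<in> {v \<in> C. 1 * F y v + g v \<le> e}"
      by (intro closed_convex_weakly_closed[OF sublevel_closed_convex[OF y] G(2) _ transfer[OF x_minus_w]])
        auto
    then show "1 * F y p + inner (B y) (p - y) \<le> 0 + e" by (simp add: g_def)
  qed
  have "continuous_on C B"
    using lipschitz_on_continuous_on[OF B_lip] C_dom by (rule continuous_on_subset)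
  then have "F p y + inner (B p) (y - p) \<ge> 0" if "y \<in> C" for y
    using minty[OF zero_less_one _ pC le that] by simp
  then show ?thesis using pS pC by (auto simp: Sol_def solutions_def)
qed

theorem iterates_converge_weakly: "\<exists>l\<in>Sol. weakly_converges x l"
proof (rule opial)
  show "Sol \<noteq> {}" using solutions_nonempty by (simp add: Sol_def)
  show "convergent (\<lambda>n. norm (x n - p))" if "p \<in> Sol" for p by (rule distance_convergent[OF that])
  show "p \<in> Sol" if "G \<le> sequentially" "G \<noteq> bot"
    "\<And>u. ((\<lambda>n. inner (x n) u) \<longlongrightarrow> inner p u) G" for G p
    by (rule cluster_point_solves[OF that])
qed

end

section \<open>Convergence of the routine\<close>

lemma dependent_extension:
  fixes x :: "nat \<Rightarrow> 'a"
  assumes total: "\<And>n y. y \<in> D \<Longrightarrow> \<exists>y'\<in>D. R n y y'"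
    and last: "x m \<in> D" and run: "\<And>n. n < m \<Longrightarrow> R n (x n) (x (Suc n))"
  shows "\<exists>x'. (\<forall>n\<le>m. x' n = x n) \<and> (\<forall>n. R n (x' n) (x' (Suc n)))"
proof -
  define T where "T n y = (SOME y'. y' \<in> D \<and> R n y y')" for n y
  have T: "T n y \<in> D \<and> R n y (T n y)" if "y \<in> D" for n y
    unfolding T_def by (rule someI_ex[of "\<lambda>y'. y' \<in> D \<and> R n y y'"])
      (use total[OF that, of n] in blast)
  define g where "g = rec_nat (x m) (\<lambda>j. T (m + j))"
  have g_Suc: "g (Suc j) = T (m + j) (g j)" for j by (simp add: g_def)
  have g_D: "g j \<in> D" for j by (induction j) (use last T in \<open>simp_all add: g_def\<close>)
  define x' where "x' n = (if n \<le> m then x n else g (n - m))" for n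
  have tail: "x' (m + j) = g j" for j by (auto simp: x'_def g_def)
  have "R n (x' n) (x' (Suc n))" for n
  proof (cases "n < m")
    case True
    then show ?thesis using run by (simp add: x'_def)
  next
    case False
    then obtain j where j: "n = m + j" using le_Suc_ex not_less by blast
    show ?thesis using T[OF g_D[of j], of n] tail[of j] tail[of "Suc j"] by (simp add: j g_Suc)
  qed
  then show ?thesis by (intro exI[of _ x']) (simp add: x'_def)
qed

text \<open>A run can be prolonged because every resolvent is nonempty with values in \<open>C\<close>, hence in \<open>domB\<close>, and by
  hypothesis the averages of points of the sets \<open>S i\<close> return to \<open>domB\<close>. Step sizes are at most \<open>1 / chi\<close>, so the collected errors
  \<open>\<eta>\<close> are summable and the run is a perturbed iteration.\<close>

theorem proposition4p7:
  fixes C domB :: "'a::{real_inner, complete_space} set"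
    and F :: "'a \<Rightarrow> 'a \<Rightarrow> real" and B :: "'a \<Rightarrow> 'a"
    and I :: "'i set" and S :: "'i \<Rightarrow> 'a set" and In :: "nat \<Rightarrow> 'i set"
    and M :: "'i \<Rightarrow> nat" and N :: nat
    and \<omega> :: "'i \<Rightarrow> nat \<Rightarrow> real" and \<gamma> \<delta> :: "nat \<Rightarrow> real" and \<epsilon> chi :: real
    and e1 e2 :: "nat \<Rightarrow> 'a" and x0 :: 'a
  assumes C: "C \<noteq> {}" "closed C" "convex C"
    and F_diag: "\<And>x. x \<in> C \<Longrightarrow> F x x = 0"
    and F_mono: "\<And>x y. x \<in> C \<Longrightarrow> y \<in> C \<Longrightarrow> F x y + F y x \<le> 0"
    and F_lsc: "\<And>x. x \<in> C \<Longrightarrow> lsc_on C (F x)"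
    and F_convex: "\<And>x. x \<in> C \<Longrightarrow> convex_on C (F x)"
    and F_hemi: "\<And>x y z. x \<in> C \<Longrightarrow> y \<in> C \<Longrightarrow> z \<in> C \<Longrightarrow>
      Limsup (at_right 0) (\<lambda>t. ereal (F ((1 - t) *\<^sub>R x + t *\<^sub>R z) y)) \<le> ereal (F x y)"
    and I: "countable I"
    and S: "\<And>i. i \<in> I \<Longrightarrow> closed (S i)" "\<And>i. i \<in> I \<Longrightarrow> convex (S i)"
      "(\<Inter>i\<in>I. S i) \<noteq> {}"
    and chi_pos: "chi > 0"
    and B: "monotone_operator_on domB B" "chi-lipschitz_on domB B"
    and domB: "C \<subseteq> domB" "(\<Union>i\<in>I. S i) \<subseteq> interior domB"
    and ex_sol: "solutions (\<Inter>i\<in>I. S i) C F B \<noteq> {}"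
    and In: "\<And>n. finite (In n)" "\<And>n. In n \<subseteq> I"
    and M: "\<And>i. i \<in> I \<Longrightarrow> M i > 0" and N: "N > 0"
    and control: "\<And>i n. i \<in> I \<Longrightarrow> i \<in> (\<Union>k\<in>{n..n + M i - 1}. In k)"
    and card_In: "\<And>n. 1 \<le> card (In n)" "\<And>n. card (In n) \<le> N"
    and errors: "summable (\<lambda>n. norm (e1 n))" "summable (\<lambda>n. norm (e2 n))"
    and delta: "\<And>n. \<delta> n > 0" "summable (\<lambda>n. sqrt (\<delta> n))"
    and eps: "0 < \<epsilon>" "\<epsilon> < 1 / (chi + 1)"
    and gamma: "\<And>n. \<gamma> n \<in> {\<epsilon>..(1 - \<epsilon>) / chi}"
    and omega: "\<And>n i. i \<in> In n \<Longrightarrow> \<omega> i n \<in> {\<epsilon>..1}" "\<And>n. (\<Sum>i\<in>In n. \<omega> i n) = 1"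
    and x0: "x0 \<in> domB"
  shows "let step = (\<lambda>n. routine_step domB B C F S (In n) (\<lambda>i. \<omega> i n) (\<gamma> n) (\<delta> n) (e1 n) (e2 n))
    in (\<forall>n y. resolvent C (\<lambda>u v. \<gamma> n * F u v) (\<delta> n) y \<noteq> {}) \<and>
       (\<forall>i\<in>I. \<forall>z. \<exists>!p. nearest_in (S i) z p) \<and>
       ((\<forall>n p. (\<forall>i\<in>In n. p i \<in> S i) \<longrightarrow> (\<Sum>i\<in>In n. \<omega> i n *\<^sub>R p i) \<in> domB) \<longrightarrow>
         (\<forall>m x. x 0 = x0 \<and> (\<forall>n<m. step n (x n) (x (Suc n))) \<longrightarrow>
           (\<exists>x'. (\<forall>n\<le>m. x' n = x n) \<and> (\<forall>n. step n (x' n) (x' (Suc n)))))) \<and>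
       (\<forall>x. x 0 = x0 \<and> (\<forall>n. step n (x n) (x (Suc n))) \<longrightarrow>
         (\<exists>l\<in>solutions (\<Inter>i\<in>I. S i) C F B. weakly_converges x l))"
proof -
  interpret equilibrium_bifunction C F
    using C F_diag F_mono F_lsc F_convex F_hemi by unfold_locales
  define step where
    "step n = routine_step domB B C F S (In n) (\<lambda>i. \<omega> i n) (\<gamma> n) (\<delta> n) (e1 n) (e2 n)" for n
  have g: "\<gamma> n > 0" "\<gamma> n * chi \<le> 1 - \<epsilon>" for n
    using gamma[of n] eps(1) chi_pos by (auto simp: field_simps)
  have g1: "\<gamma> n * chi \<le> 1" for n using g(2)[of n] eps(1) by linarith
  have S_ne: "S i \<noteq> {}" if "i \<in> I" for i using S(3) that by blast
  have res: "resolvent C (\<lambda>u v. \<gamma> n * F u v) (\<delta> n) y \<noteq> {}" for n y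
    using g(1) delta(1) by (intro resolvent_nonempty) (auto intro: less_imp_le)
  have extend: "\<exists>x'. (\<forall>n\<le>m. x' n = x n) \<and> (\<forall>n. step n (x' n) (x' (Suc n)))"
    if avg: "\<forall>n p. (\<forall>i\<in>In n. p i \<in> S i) \<longrightarrow> (\<Sum>i\<in>In n. \<omega> i n *\<^sub>R p i) \<in> domB"
      and x: "x 0 = x0" "\<forall>n<m. step n (x n) (x (Suc n))" for m x
  proof (rule dependent_extension[where D = domB])
    have avg': "(\<Sum>i\<in>In n. \<omega> i n *\<^sub>R projector (S i) z) \<in> domB" for n z
    proof (rule avg[rule_format])
      show "projector (S i) z \<in> S i" if "i \<in> In n" for i
        using projector_in[OF S(1,2) S_ne] that In(2) by (meson subsetD)
    qed
    show "\<exists>y'\<in>domB. step n y y'" if y: "y \<in> domB" for n y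
    proof -
      obtain q where q: "q \<in> resolvent C (\<lambda>u v. \<gamma> n * F u v) (\<delta> n) (y - \<gamma> n *\<^sub>R (B y + e1 n))"
        using res by blast
      then have "q \<in> domB" using domB(1) by (auto simp: resolvent_def)
      then show ?thesis
        using y q avg' unfolding step_def routine_step_def by blast
    qed
    show "x m \<in> domB"
    proof (cases m)
      case 0
      then show ?thesis using x(1) x0 by simp
    next
      case (Suc n)
      then have "step n (x n) (x m)" using x(2) by blast
      then obtain z where "x m = (\<Sum>i\<in>In n. \<omega> i n *\<^sub>R projector (S i) z)"
        unfolding step_def routine_step_def by blast
      then show ?thesis using avg' by simp
    qed
    show "step n (x n) (x (Suc n))" if "n < m" for n using x(2) that by blast
  qed
  have converge: "\<exists>l\<in>solutions (\<Inter>i\<in>I. S i) C F B. weakly_converges x l"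
    if x: "\<And>n. step n (x n) (x (Suc n))" for x
  proof -
    define \<eta> where "\<eta> n = 2 * sqrt (\<delta> n) + 3 * (1 / chi * norm (e1 n)) + 1 / chi * norm (e2 n)" for n
    define Q where "Q n w z \<longleftrightarrow> w \<in> resolvent C (\<lambda>u v. \<gamma> n * F u v) 0 (x n - \<gamma> n *\<^sub>R B (x n)) \<and>
        norm (z - (w + \<gamma> n *\<^sub>R (B (x n) - B w))) \<le> \<eta> n \<and>
        x (Suc n) = (\<Sum>i\<in>In n. \<omega> i n *\<^sub>R projector (S i) z)" for n w z
    have "\<exists>w z. Q n w z" for n
    proof -
      have "\<gamma> n \<le> 1 / chi" using g1[of n] chi_pos by (simp add: field_simps)
      then have "2 * sqrt (\<delta> n) + 3 * (\<gamma> n * norm (e1 n)) + \<gamma> n * norm (e2 n) \<le> \<eta> n"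
        unfolding \<eta>_def by (intro add_mono mult_left_mono mult_right_mono) auto
      then show ?thesis
        using routine_step_perturbation[OF x[of n, unfolded step_def] g(1) g1
            less_imp_le[OF delta(1)] B(2) domB(1)]
        unfolding Q_def by (meson order_trans)
    qed
    then obtain w z where "\<And>n. Q n (w n) (z n)" by metis
    then have wz: "w n \<in> resolvent C (\<lambda>u v. \<gamma> n * F u v) 0 (x n - \<gamma> n *\<^sub>R B (x n))"
      "norm (z n - (w n + \<gamma> n *\<^sub>R (B (x n) - B (w n)))) \<le> \<eta> n"
      "x (Suc n) = (\<Sum>i\<in>In n. \<omega> i n *\<^sub>R projector (S i) (z n))" for n
      by (simp_all add: Q_def)
    interpret perturbed_iteration C F domB B chi \<epsilon> I S In M \<omega> \<gamma> \<eta> x w z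
    proof
      show "monotone_operator_on domB B" "chi-lipschitz_on domB B" "C \<subseteq> domB"
        by (fact B(1) B(2) domB(1))+
      show "closed (S i)" "convex (S i)" if "i \<in> I" for i using S that by auto
      show "solutions (\<Inter>i\<in>I. S i) C F B \<noteq> {}" by (fact ex_sol)
      show "In n \<subseteq> I" "finite (In n)" for n by (fact In)+
      show "\<exists>k\<in>{n..n + M i}. i \<in> In k" if "i \<in> I" for i n
        using control[OF that, of n] by fastforce
      show "\<epsilon> > 0" by (fact eps(1))
      show "\<omega> i n \<ge> \<epsilon>" if "i \<in> In n" for i n using omega(1)[OF that] by simp
      show "(\<Sum>i\<in>In n. \<omega> i n) = 1" for n by (fact omega(2))
      show "\<gamma> n \<ge> \<epsilon>" "\<gamma> n * chi \<le> 1 - \<epsilon>" for n using gamma[of n] g(2) by auto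
      show "x n \<in> domB" for n using x[of n] unfolding step_def routine_step_def by blast
      show "summable \<eta>"
        unfolding \<eta>_def by (intro summable_add summable_mult errors delta(2))
    qed (fact wz)+
    show ?thesis using iterates_converge_weakly unfolding Sol_def .
  qed
  show ?thesis
    unfolding Let_def step_def[symmetric]
  proof (intro conjI allI impI ballI)
    show "resolvent C (\<lambda>u v. \<gamma> n * F u v) (\<delta> n) y \<noteq> {}" for n y by (rule res)
    show "\<exists>!p. nearest_in (S i) z p" if "i \<in> I" for i z
      using that by (intro nearest_in_ex1 S(1,2) S_ne)
  qed ((elim conjE, rule extend; assumption), (elim conjE, rule converge, blast))
qed

end
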